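(* Let $q\ge2$ be an integer, $\beta\ge0$, and let $G=(V,E)$ be a finite graph with $N=|V|\ge 2$. Let $P=P^G_{\beta,q}$ be the transition matrix of the Swendsen-Wang dynamics, which is reversible with respect to $\pi^G_{\beta,q}$. Let $v\in V$ be any vertex, $k\in[q]$, $\Lambda_v^k:=\{\sigma\in\Omega_{\rm P}:\sigma(v)=k\}$, and let $P_{\Lambda_v^k}$ be the transition matrix of the heat-bath dynamics on $\Lambda_v^k$ that leaves the color at $v$ constant. Let $\widetilde\Delta:=\max_{u\in V\setminus\{v\}}\deg_G(u)$. Then $$\lambda(P)\;\ge\;\widetilde c_{\rm SW}\,\lambda\bigl(P_{\Lambda_v^k}^2\bigr),\qquad\text{where}\qquad \widetilde c_{\rm SW}=\widetilde c_{\rm SW}(G,\beta,q):=\frac1{2q^2}\left(q\,e^{2\beta}\right)^{-4\widetilde\Delta}.$$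
   Context: Graphs are finite with vertex set $V$ and edge set $E\subseteq\binom V2$ (simple, undirected). $\deg_G(u)$ is the degree of $u$. $[q]=\{1,\dots,q\}$ and $\Omega_{\rm P}=[q]^V$. Potts model: for $\sigma\in\Omega_{\rm P}$ put $E(\sigma):=\{\{u,w\}\in E:\sigma(u)=\sigma(w)\}$. The Boltzmann distribution is $\pi^{G}_{\beta,q}(\sigma)=\frac1Z\exp(\beta\,|E(\sigma)|)$, with $Z$ the normalizing constant. Heat-bath dynamics with the color at $v$ fixed: for $\sigma\in\Omega_{\rm P}$, $u\in V$, $l\in[q]$ let $\sigma^{u,l}$ be the configuration with $\sigma^{u,l}(u)=l$ and $\sigma^{u,l}(w)=\sigma(w)$ for $w\ne u$. For $\sigma,\tau\in\Lambda_v^k$, $$P_{\Lambda_v^k}(\sigma,\tau)=\frac1{N-1}\sum_{u\in V\setminus\{v\}}\sum_{l\in[q]}\frac{\pi^G_{\beta,q}(\sigma^{u,l}\mid\Lambda_v^k)}{\sum_{j\in[q]}\pi^G_{\beta,q}(\sigma^{u,j}\mid\Lambda_v^k)}\,\mathbf 1(\tau=\sigma^{u,l}),$$ which is reversible with respect to the conditional measure $\pi^G_{\beta,q}(\cdot\mid\Lambda_v^k)$ on $\Lambda_v^k$. Swendsen-Wang dynamics: with $p=1-e^{-\beta}$ and $C(A)$ the number of connected components of $(V,A)$ (isolated vertices counted), $$P(\sigma,\tau)=\sum_{A\subseteq E(\sigma)\cap E(\tau)}p^{|A|}(1-p)^{|E(\sigma)|-|A|}\,q^{-C(A)},\qquad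 \sigma,\tau\in\Omega_{\rm P}$$ (convention $0^0=1$). Spectral gap: for a transition matrix $K$ on a finite set $\Omega$ reversible with respect to a probability measure $\pi$, with (real) eigenvalues $1=\xi_0\ge\xi_1\ge\dots\ge\xi_{|\Omega|-1}\ge-1$, set $\lambda(K):=1-\max\{\xi_1,|\xi_{|\Omega|-1}|\}$. *)

theory Defs
  imports
    Complex_Main
    "HOL-Library.FuncSet"
    "HOL-Library.Multiset"
    "HOL-Library.Countable_Set"
    "HOL-Computational_Algebra.Polynomial"
    "Jordan_Normal_Form.Char_Poly"
begin

definition simple_graph :: "'a set \<Rightarrow> 'a set set \<Rightarrow> bool" where
  "simple_graph V E \<longleftrightarrow> finite V \<and> E \<subseteq> {e. e \<subseteq> V \<and> card e = 2}"

definition vertex_degree :: "'a set set \<Rightarrow> 'a \<Rightarrow> nat" where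
  "vertex_degree E u = card {e \<in> E. u \<in> e}"

definition components :: "'a set \<Rightarrow> 'a set set \<Rightarrow> 'a set set" where
  "components V A = V // {(u, w) \<in> V \<times> V. (u, w) \<in> {(x, y). {x, y} \<in> A}\<^sup>*}"


type_synonym 'a config = "'a \<Rightarrow> nat"

definition configs :: "'a set \<Rightarrow> nat \<Rightarrow> 'a config set" where
  "configs V q = V \<rightarrow>\<^sub>E {1..q}"

definition configs_fixed :: "'a set \<Rightarrow> nat \<Rightarrow> 'a \<Rightarrow> nat \<Rightarrow> 'a config set" where
  "configs_fixed V q v k = {\<sigma> \<in> configs V q. \<sigma> v = k}"

definition mono_edges :: "'a set set \<Rightarrow> 'a config \<Rightarrow> 'a set set" where
  "mono_edges E \<sigma> = {{u, w} | u w. {u, w} \<in> E \<and> \<sigma> u = \<sigma> w}"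

definition potts :: "'a set \<Rightarrow> 'a set set \<Rightarrow> real \<Rightarrow> nat \<Rightarrow> 'a config \<Rightarrow> real" where
  "potts V E \<beta> q \<sigma> =
     exp (\<beta> * real (card (mono_edges E \<sigma>))) /
     (\<Sum>\<tau>\<in>configs V q. exp (\<beta> * real (card (mono_edges E \<tau>))))"

definition conditional :: "('s \<Rightarrow> real) \<Rightarrow> 's set \<Rightarrow> 's \<Rightarrow> real" where
  "conditional \<pi> \<Lambda> \<sigma> = (if \<sigma> \<in> \<Lambda> then \<pi> \<sigma> / (\<Sum>\<tau>\<in>\<Lambda>. \<pi> \<tau>) else 0)"


definition swendsen_wang ::
  "'a set \<Rightarrow> 'a set set \<Rightarrow> real \<Rightarrow> nat \<Rightarrow> 'a config \<Rightarrow> 'a config \<Rightarrow> real" where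
  "swendsen_wang V E \<beta> q \<sigma> \<tau> =
     (let p = 1 - exp (- \<beta>) in
      \<Sum>A | A \<subseteq> mono_edges E \<sigma> \<inter> mono_edges E \<tau>.
        p ^ card A * (1 - p) ^ (card (mono_edges E \<sigma>) - card A)
        * real q powi (- int (card (components V A))))"

definition heat_bath_fixed ::
  "'a set \<Rightarrow> 'a set set \<Rightarrow> real \<Rightarrow> nat \<Rightarrow> 'a \<Rightarrow> nat \<Rightarrow> 'a config \<Rightarrow> 'a config \<Rightarrow> real" where
  "heat_bath_fixed V E \<beta> q v k \<sigma> \<tau> =
     (let \<pi> = conditional (potts V E \<beta> q) (configs_fixed V q v k) in
      1 / (real (card V) - 1) *
      (\<Sum>u\<in>V - {v}. \<Sum>l\<in>{1..q}.
         \<pi> (\<sigma>(u := l)) / (\<Sum>j\<in>{1..q}. \<pi> (\<sigma>(u := j))) * of_bool (\<tau> = \<sigma>(u := l))))"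


definition reversible :: "'s set \<Rightarrow> ('s \<Rightarrow> real) \<Rightarrow> ('s \<Rightarrow> 's \<Rightarrow> real) \<Rightarrow> bool" where
  "reversible \<Omega> \<pi> K \<longleftrightarrow> (\<forall>\<sigma>\<in>\<Omega>. \<forall>\<tau>\<in>\<Omega>. \<pi> \<sigma> * K \<sigma> \<tau> = \<pi> \<tau> * K \<tau> \<sigma>)"

lemma finite_mono_edges:
  assumes "simple_graph V E"
  shows "finite (mono_edges E \<sigma>)"
proof -
  have "E \<subseteq> Pow V" using assms by (auto simp: simple_graph_def)
  then have "finite E" using assms finite_subset by (auto simp: simple_graph_def)
  then show ?thesis by (rule rev_finite_subset) (auto simp: mono_edges_def)
qed

lemma reversible_swendsen_wang:
  assumes G: "simple_graph V E"
  shows "reversible (configs V q) (potts V E \<beta> q) (swendsen_wang V E \<beta> q)"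
proof -
  define Z where "Z = (\<Sum>\<tau>\<in>configs V q. exp (\<beta> * real (card (mono_edges E \<tau>))))"
  define w where "w A = (1 - exp (- \<beta>)) ^ card A * exp (\<beta> * real (card A))
      * real q powi (- int (card (components V A)))" for A
  have *: "potts V E \<beta> q \<sigma> * swendsen_wang V E \<beta> q \<sigma> \<tau> =
      (\<Sum>A | A \<subseteq> mono_edges E \<sigma> \<inter> mono_edges E \<tau>. w A) / Z" for \<sigma> \<tau>
  proof -
    have "exp (\<beta> * real (card (mono_edges E \<sigma>)))
        * ((1 - exp (- \<beta>)) ^ card A * (1 - (1 - exp (- \<beta>))) ^ (card (mono_edges E \<sigma>) - card A)
           * real q powi (- int (card (components V A)))) = w A"
      if "A \<subseteq> mono_edges E \<sigma> \<inter> mono_edges E \<tau>" for A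
    proof -
      have "card A \<le> card (mono_edges E \<sigma>)"
        using that finite_mono_edges[OF G] by (auto intro: card_mono)
      then have "exp (\<beta> * real (card (mono_edges E \<sigma>)))
          * exp (- \<beta>) ^ (card (mono_edges E \<sigma>) - card A) = exp (\<beta> * real (card A))"
        by (simp add: exp_of_nat_mult[symmetric] exp_add[symmetric] of_nat_diff algebra_simps)
      then show ?thesis unfolding w_def by (simp add: mult_ac)
    qed
    then have "exp (\<beta> * real (card (mono_edges E \<sigma>)))
        * swendsen_wang V E \<beta> q \<sigma> \<tau> = (\<Sum>A | A \<subseteq> mono_edges E \<sigma> \<inter> mono_edges E \<tau>. w A)"
      unfolding swendsen_wang_def Let_def sum_distrib_left
      by (intro sum.cong[OF refl]) (simp only: mem_Collect_eq)
    then show ?thesis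
      unfolding potts_def Z_def[symmetric] by (simp only: times_divide_eq_left)
  qed
  show ?thesis unfolding reversible_def * by (auto simp: Int_commute)
qed

lemma reversible_heat_bath_fixed:
  "reversible (configs_fixed V q v k)
     (conditional (potts V E \<beta> q) (configs_fixed V q v k)) (heat_bath_fixed V E \<beta> q v k)"
proof -
  define \<pi> where "\<pi> = conditional (potts V E \<beta> q) (configs_fixed V q v k)"
  have "\<pi> \<sigma> * (\<Sum>l\<in>{1..q}. \<pi> (\<sigma>(u := l)) / (\<Sum>j\<in>{1..q}. \<pi> (\<sigma>(u := j))) * of_bool (\<tau> = \<sigma>(u := l)))
      = \<pi> \<tau> * (\<Sum>l\<in>{1..q}. \<pi> (\<tau>(u := l)) / (\<Sum>j\<in>{1..q}. \<pi> (\<tau>(u := j))) * of_bool (\<sigma> = \<tau>(u := l)))"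
    if st: "\<sigma> \<in> configs_fixed V q v k" "\<tau> \<in> configs_fixed V q v k" and u: "u \<in> V"
    for \<sigma> \<tau> u
  proof -
    have one: "(\<Sum>l\<in>{1..q}. \<pi> (\<sigma>(u := l)) / (\<Sum>j\<in>{1..q}. \<pi> (\<sigma>(u := j))) * of_bool (\<tau> = \<sigma>(u := l)))
        = (if \<tau> = \<sigma>(u := \<tau> u) then \<pi> \<tau> / (\<Sum>j\<in>{1..q}. \<pi> (\<sigma>(u := j))) else 0)"
      if t: "\<tau> \<in> configs_fixed V q v k" for \<sigma> \<tau>
    proof -
      have "\<tau> u \<in> {1..q}" using t u by (auto simp: configs_fixed_def configs_def)
      have "(\<Sum>l\<in>{1..q}. \<pi> (\<sigma>(u := l)) / (\<Sum>j\<in>{1..q}. \<pi> (\<sigma>(u := j))) * of_bool (\<tau> = \<sigma>(u := l)))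
        = (\<Sum>l\<in>{1..q}. if l = \<tau> u then
            (if \<tau> = \<sigma>(u := \<tau> u) then \<pi> \<tau> / (\<Sum>j\<in>{1..q}. \<pi> (\<sigma>(u := j))) else 0) else 0)"
        by (rule sum.cong[OF refl]) auto
      also have "\<dots> = (if \<tau> = \<sigma>(u := \<tau> u) then \<pi> \<tau> / (\<Sum>j\<in>{1..q}. \<pi> (\<sigma>(u := j))) else 0)"
        using \<open>\<tau> u \<in> {1..q}\<close> by simp
      finally show ?thesis .
    qed
    have sym: "\<tau> = \<sigma>(u := \<tau> u) \<longleftrightarrow> \<sigma> = \<tau>(u := \<sigma> u)"
      by (metis fun_upd_triv fun_upd_upd)
    show ?thesis
    proof (cases "\<tau> = \<sigma>(u := \<tau> u)")
      case True
      then have eq: "\<sigma>(u := j) = \<tau>(u := j)" for j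
        by (metis fun_upd_upd)
      have "\<sigma> = \<tau>(u := \<sigma> u)" using True sym by blast
      show ?thesis
        unfolding one[OF st(1)] one[OF st(2)] if_P[OF True] if_P[OF \<open>\<sigma> = \<tau>(u := \<sigma> u)\<close>]
        unfolding eq by (simp only: times_divide_eq_right mult.commute)
    next
      case False
      then have "\<sigma> \<noteq> \<tau>(u := \<sigma> u)" using sym by blast
      show ?thesis
        unfolding one[OF st(1)] one[OF st(2)] if_not_P[OF False]
          if_not_P[OF \<open>\<sigma> \<noteq> \<tau>(u := \<sigma> u)\<close>] by (simp only: mult_zero_right)
    qed
  qed
  note balance = this
  have "\<pi> \<sigma> * heat_bath_fixed V E \<beta> q v k \<sigma> \<tau> = \<pi> \<tau> * heat_bath_fixed V E \<beta> q v k \<tau> \<sigma>"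
    if st: "\<sigma> \<in> configs_fixed V q v k" "\<tau> \<in> configs_fixed V q v k" for \<sigma> \<tau>
  proof -
    have "\<pi> \<sigma> * (\<Sum>u\<in>V - {v}. \<Sum>l\<in>{1..q}.
          \<pi> (\<sigma>(u := l)) / (\<Sum>j\<in>{1..q}. \<pi> (\<sigma>(u := j))) * of_bool (\<tau> = \<sigma>(u := l)))
      = \<pi> \<tau> * (\<Sum>u\<in>V - {v}. \<Sum>l\<in>{1..q}.
          \<pi> (\<tau>(u := l)) / (\<Sum>j\<in>{1..q}. \<pi> (\<tau>(u := j))) * of_bool (\<sigma> = \<tau>(u := l)))"
      unfolding sum_distrib_left[of _ _ "V - {v}"]
      by (rule sum.cong[OF refl], rule balance[OF st]) blast
    then have "\<pi> \<sigma> * (c * (\<Sum>u\<in>V - {v}. \<Sum>l\<in>{1..q}.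
          \<pi> (\<sigma>(u := l)) / (\<Sum>j\<in>{1..q}. \<pi> (\<sigma>(u := j))) * of_bool (\<tau> = \<sigma>(u := l))))
      = \<pi> \<tau> * (c * (\<Sum>u\<in>V - {v}. \<Sum>l\<in>{1..q}.
          \<pi> (\<tau>(u := l)) / (\<Sum>j\<in>{1..q}. \<pi> (\<tau>(u := j))) * of_bool (\<sigma> = \<tau>(u := l))))" for c
      by (simp only: mult.left_commute[of _ c])
    then show ?thesis
      unfolding heat_bath_fixed_def Let_def \<pi>_def[symmetric] .
  qed
  then show ?thesis unfolding reversible_def \<pi>_def by blast
qed


text \<open>For finite \<open>\<Omega>\<close>, \<^const>\<open>from_nat_into\<close> enumerates \<open>\<Omega>\<close> bijectively by \<open>{..<card \<Omega>}\<close>.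
  Changing the enumeration conjugates the matrix by a permutation matrix and hence does
  not affect its characteristic polynomial.\<close>

definition kernel_mat :: "'s set \<Rightarrow> ('s \<Rightarrow> 's \<Rightarrow> real) \<Rightarrow> real mat" where
  "kernel_mat \<Omega> K =
     mat (card \<Omega>) (card \<Omega>) (\<lambda>(i, j). K (from_nat_into \<Omega> i) (from_nat_into \<Omega> j))"

text \<open>The real eigenvalues in decreasing order, repeated according to their algebraic
  multiplicity. A reversible kernel with a positive reversible measure is similar to a real
  symmetric matrix, so for it this list contains all \<^term>\<open>dim_row M\<close> eigenvalues, and
  the algebraic and geometric multiplicities agree.\<close>

definition eigenvalues_desc :: "real mat \<Rightarrow> real list" where
  "eigenvalues_desc M = rev (sorted_list_of_multiset (proots (char_poly M)))"

text \<open>Meaningful for matrices of dimension at least 2.\<close>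

definition spectral_gap :: "real mat \<Rightarrow> real" where
  "spectral_gap M =
     1 - max (eigenvalues_desc M ! 1) \<bar>eigenvalues_desc M ! (dim_row M - 1)\<bar>"

end

theory Submission
  imports Defs "Jordan_Normal_Form.Conjugate"
begin

text \<open>
  Given a random edge set \<open>A\<close>, a Swendsen-Wang step recolours the components of \<open>(V, A)\<close> independently
  and uniformly, so its Dirichlet form is the average over \<open>A\<close> of the variance over the colourings
  compatible with \<open>A\<close>. Averaging over the colour of \<open>v\<close> can only help, which reduces everything to
  functions on the configurations with \<open>v\<close> coloured \<open>k\<close>. If \<open>u\<close> is isolated in \<open>A\<close>, which has
  conditional probability at least \<open>exp (- \<beta> * deg u)\<close>, the compatible colourings are closed under
  recolouring \<open>u\<close> and their variance dominates the single-site variance at \<open>u\<close>; and the uniform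
  single-site variance dominates the heat-bath one by the variational characterisation of conditional
  expectations. Averaging over \<open>u\<close> compares the Swendsen-Wang Dirichlet form with that of the heat
  bath \<open>Q\<close>, and \<open>\<langle>h, h\<rangle> - \<langle>Qh, Qh\<rangle> \<le> 2 (\<langle>h, h\<rangle> - \<langle>h, Qh\<rangle>)\<close> passes to \<open>Q\<^sup>2\<close>. The constant obtained is
  \<open>exp (- \<beta> * \<Delta>) / 2\<close>, which is larger than the required one.
\<close>

section \<open>Diagonalization of real symmetric matrices\<close>

text \<open>The witness is the reflection in the hyperplane orthogonal to \<open>w\<close>, the
  difference of \<open>v\<close> and the first unit vector. It exchanges these two unit vectors and
  is symmetric and an involution, hence orthogonal. If the difference vanishes, the identity
  serves.\<close>

lemma householder_reflection:
  fixes v :: "real vec"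
  assumes v: "v \<in> carrier_vec n" and "n > 0" and unit: "v \<bullet> v = 1"
  obtains W where "W \<in> carrier_mat n n" "transpose_mat W = W" "W * W = 1\<^sub>m n" "col W 0 = v"
proof (cases "v = unit_vec n 0")
  case True
  show thesis by (rule that[of "1\<^sub>m n"]) (use True \<open>n > 0\<close> in auto)
next
  case False
  define w where "w i = v $ i - of_bool (i = 0)" for i
  define s where "s = (\<Sum>i<n. w i * w i)"
  have vv: "(\<Sum>i<n. v $ i * v $ i) = 1"
    using unit v by (simp add: scalar_prod_def lessThan_atLeast0)
  have "s = (\<Sum>i<n. v $ i * v $ i + (if i = 0 then 1 - 2 * v $ 0 else 0))"
    unfolding s_def by (rule sum.cong) (auto simp: w_def algebra_simps)
  also have "\<dots> = 2 - 2 * v $ 0"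
    using vv \<open>n > 0\<close> by (simp add: sum.distrib)
  finally have s: "s = 2 - 2 * v $ 0" .
  obtain i where "i < n" "w i \<noteq> 0"
  proof -
    have "\<exists>i<n. v $ i \<noteq> unit_vec n 0 $ i" using False v by (metis eq_vecI carrier_vecD index_unit_vec(3))
    then show thesis using that by (auto simp: w_def split: if_splits)
  qed
  then have "s > 0"
    unfolding s_def by (intro sum_pos2[of _ i]) (auto simp flip: power2_eq_square)
  \<comment> \<open>\<open>s\<close> is the squared length of \<open>w\<close>; with
    \<open>c = 2 / s\<close> the terms \<open>- 2 * c\<close> and \<open>c * c * s\<close> cancel in
    the square of \<open>W\<close>.\<close>
  define c where "c = 2 / s"
  define W where "W = mat n n (\<lambda>(i, j). of_bool (i = j) - c * w i * w j)"
  have W: "W \<in> carrier_mat n n" by (simp add: W_def)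
  show thesis
  proof (rule that[OF W])
    show "transpose_mat W = W"
      by (rule eq_matI) (auto simp: W_def)
    show "W * W = 1\<^sub>m n"
    proof (rule eq_matI)
      fix i j assume "i < dim_row (1\<^sub>m n :: real mat)" "j < dim_col (1\<^sub>m n :: real mat)"
      then have ij: "i < n" "j < n" by auto
      have "(W * W) $$ (i, j) = (\<Sum>k<n. (of_bool (i = k) - c * w i * w k) * (of_bool (k = j) - c * w k * w j))"
        using ij by (simp add: W_def scalar_prod_def lessThan_atLeast0)
      also have "\<dots> = (\<Sum>k<n. (if k = i then of_bool (i = j) - c * w i * w j else 0)
          + (if k = j then - (c * w i * w j) else 0) + (c * c * w i * w j) * (w k * w k))"
        by (rule sum.cong) (auto simp: algebra_simps)
      also have "\<dots> = of_bool (i = j) - 2 * c * w i * w j + c * c * w i * w j * s"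
        using ij by (simp add: sum.distrib flip: sum_distrib_left s_def)
      also have "\<dots> = of_bool (i = j)"
        using \<open>s > 0\<close> by (simp add: c_def field_simps)
      finally show "(W * W) $$ (i, j) = 1\<^sub>m n $$ (i, j)" using ij by simp
    qed (use W in auto)
    \<comment> \<open>Since \<open>v\<close> has length one, \<open>s = - 2 * w 0\<close>. The first
      column of \<open>W\<close> is therefore the first unit vector plus \<open>w\<close>, which is
      \<open>v\<close>.\<close>
    have cw: "c * w 0 = - 1"
      using \<open>s > 0\<close> s by (simp add: c_def w_def field_simps)
    show "col W 0 = v"
    proof (rule eq_vecI)
      fix i assume "i < dim_vec v"
      then have i: "i < n" using v by simp
      have "of_bool (i = 0) - c * w i * w 0 = of_bool (i = 0) - w i * (c * w 0)" by simp
      also have "\<dots> = v $ i" unfolding cw by (simp add: w_def)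
      finally have "of_bool (i = 0) - c * w i * w 0 = v $ i" .
      then show "col W 0 $ i = v $ i"
        using i \<open>n > 0\<close> by (simp add: W_def)
    qed (use W v in auto)
  qed
qed

text \<open>Deflation along the list of roots: a reflection turns a unit eigenvector for the first
  root into the first coordinate vector, symmetry clears the rest of that row and column, and the
  remaining block has the remaining roots. The list may come in any order, so the columns of
  \<open>W\<close> can later be aligned with the decreasing list of eigenvalues.\<close>

lemma real_symmetric_diagonalization:
  fixes A :: "real mat"
  assumes "A \<in> carrier_mat n n" and "transpose_mat A = A"
    and "char_poly A = (\<Prod>e\<leftarrow>es. [:- e, 1:])"
  shows "\<exists>W\<in>carrier_mat n n. transpose_mat W * W = 1\<^sub>m n \<and> W * transpose_mat W = 1\<^sub>m n \<and>
    A * W = W * mat_diag n ((!) es)"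
  using assms
proof (induction es arbitrary: n A)
  case Nil
  with degree_monic_char_poly[of A n] have "n = 0" by auto
  then show ?case using Nil by (intro bexI[of _ "1\<^sub>m 0"]) (auto intro!: eq_matI simp: mat_diag_def)
next
  case (Cons e es n A)
  note A = Cons.prems(1) and sym = Cons.prems(2) and cp = Cons.prems(3)
  have "degree (char_poly A) = n" using degree_monic_char_poly[OF A] by simp
  moreover have "degree (\<Prod>e\<leftarrow>e # es. [:- e, 1:]) = length (e # es)"
    by (rule degree_linear_factors)
  ultimately have len: "n = Suc (length es)" using cp by simp
  define m where "m = length es"
  have n: "n = Suc m" using len m_def by simp
  have "eigenvalue A e"
    unfolding eigenvalue_root_char_poly[OF A] cp by simp
  then obtain u where u: "u \<in> carrier_vec n" "u \<noteq> 0\<^sub>v n" "A *\<^sub>v u = e \<cdot>\<^sub>v u"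
    using A unfolding eigenvalue_def eigenvector_def by auto
  have uu: "u \<bullet> u > 0"
    using conjugate_square_greater_0_vec[OF u(1)] u(2) by simp
  define v where "v = (1 / sqrt (u \<bullet> u)) \<cdot>\<^sub>v u"
  have v: "v \<in> carrier_vec n" using u by (simp add: v_def)
  have "v \<bullet> v = 1" using uu u(1) by (simp add: v_def)
  have Av: "A *\<^sub>v v = e \<cdot>\<^sub>v v"
    using u A by (simp add: v_def mult_mat_vec smult_smult_assoc mult.commute)
  obtain W where W: "W \<in> carrier_mat n n" "transpose_mat W = W" "W * W = 1\<^sub>m n" "col W 0 = v"
    using householder_reflection[OF v _ \<open>v \<bullet> v = 1\<close>] n by auto
  \<comment> \<open>\<open>W\<close> is its own inverse and exchanges \<open>v\<close> with the
    first unit vector, so \<open>A'\<close> is similar to \<open>A\<close>, still symmetric, and has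
    the first unit vector as eigenvector for \<open>e\<close>.\<close>
  define A' where "A' = W * A * W"
  have A': "A' \<in> carrier_mat n n" using A W by (simp add: A'_def)
  have A'sym: "transpose_mat A' = A'"
    using A W sym by (simp add: A'_def transpose_mult[of _ n n _ n] assoc_mult_mat[of _ n n _ n _ n])
  have "col A' 0 = W *\<^sub>v (A *\<^sub>v v)"
  proof -
    have "A' = W * (A * W)" using A W by (simp add: A'_def)
    then have "col A' 0 = W *\<^sub>v col (A * W) 0" using A W n by (metis col_mult2 mult_carrier_mat zero_less_Suc)
    also have "col (A * W) 0 = A *\<^sub>v col W 0" using A W n by (metis col_mult2 zero_less_Suc)
    finally show ?thesis unfolding W(4) .
  qed
  also have "\<dots> = e \<cdot>\<^sub>v (W *\<^sub>v v)" using v W unfolding Av by (simp add: mult_mat_vec)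
  also have "W *\<^sub>v v = col (W * W) 0" using W n by (metis col_mult2 zero_less_Suc)
  also have "\<dots> = unit_vec n 0" using W n by simp
  finally have col0: "col A' 0 = e \<cdot>\<^sub>v unit_vec n 0" .
  have ent0: "A' $$ (i, 0) = (if i = 0 then e else 0)" if "i < n" for i
    using arg_cong[OF col0, of "\<lambda>v. v $ i"] that A' n by (auto split: if_splits)
  have ent0': "A' $$ (0, i) = (if i = 0 then e else 0)" if "i < n" for i
    using ent0[OF that] arg_cong[OF A'sym, of "\<lambda>M. M $$ (0, i)"] that A' n by auto
  define A3 where "A3 = mat m m (\<lambda>(i, j). A' $$ (Suc i, Suc j))"
  have A3: "A3 \<in> carrier_mat m m" by (simp add: A3_def)
  let ?e = "mat 1 1 (\<lambda>_. e)"
  have block: "A' = four_block_mat ?e (0\<^sub>m 1 m) (0\<^sub>m m 1) A3"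
    by (rule eq_matI) (use A' n ent0 ent0' in \<open>auto simp: A3_def\<close>)
  have A3sym: "transpose_mat A3 = A3"
  proof (rule eq_matI)
    fix i j assume "i < dim_row A3" "j < dim_col A3"
    then have "i < m" "j < m" using A3 by auto
    then show "transpose_mat A3 $$ (i, j) = A3 $$ (i, j)"
      using arg_cong[OF A'sym, of "\<lambda>M. M $$ (Suc i, Suc j)"] A' n by (simp add: A3_def)
  qed (use A3 in auto)
  have "similar_mat A' A"
    unfolding A'_def by (rule similar_matI[of _ _ W W n]) (use W A in auto)
  then have "char_poly A' = [:- e, 1:] * (\<Prod>e\<leftarrow>es. [:- e, 1:])"
    using cp char_poly_similar by fastforce
  moreover have "char_poly A' = char_poly ?e * char_poly A3"
    unfolding block by (rule char_poly_four_block_zeros_col) (use A3 in auto)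
  moreover have "char_poly ?e = [:- e, 1:]"
    by (simp add: char_poly_defs det_def sign_def)
  ultimately have "char_poly A3 = (\<Prod>e\<leftarrow>es. [:- e, 1:])"
    by (metis mult_cancel_left pCons_eq_0_iff zero_neq_one)
  from Cons.IH[OF A3 A3sym this] obtain U where
    U: "U \<in> carrier_mat m m" "transpose_mat U * U = 1\<^sub>m m" "U * transpose_mat U = 1\<^sub>m m"
      "A3 * U = U * mat_diag m ((!) es)" by blast
  \<comment> \<open>\<open>B\<close> extends the diagonalization of the smaller block by the trivial
    one in the first coordinate; \<open>W * B\<close> then diagonalizes \<open>A\<close>.\<close>
  define B where "B = four_block_mat (1\<^sub>m 1) (0\<^sub>m 1 m) (0\<^sub>m m 1) U"
  have B: "B \<in> carrier_mat n n" using four_block_carrier_mat[of "1\<^sub>m 1" 1 1 U m m] U n by (simp add: B_def)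
  have Bt: "transpose_mat B = four_block_mat (1\<^sub>m 1) (0\<^sub>m 1 m) (0\<^sub>m m 1) (transpose_mat U)"
    unfolding B_def by (subst transpose_four_block_mat) (use U in auto)
  have one: "four_block_mat (1\<^sub>m 1) (0\<^sub>m 1 m) (0\<^sub>m m 1) (1\<^sub>m m) = (1\<^sub>m n :: real mat)"
    unfolding n by (rule eq_matI) auto
  have BtB: "transpose_mat B * B = 1\<^sub>m n"
    unfolding Bt unfolding B_def
    by (subst mult_four_block_mat[of _ 1 1 _ m _ m _ _ 1 _ m]) (use U one in auto)
  have BBt: "B * transpose_mat B = 1\<^sub>m n"
    unfolding Bt unfolding B_def
    by (subst mult_four_block_mat[of _ 1 1 _ m _ m _ _ 1 _ m]) (use U one in auto)
  have dg: "mat_diag n ((!) (e # es)) = four_block_mat ?e (0\<^sub>m 1 m) (0\<^sub>m m 1) (mat_diag m ((!) es))"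
    unfolding n by (rule eq_matI) (auto simp: mat_diag_def)
  have A'B: "A' * B = B * mat_diag n ((!) (e # es))"
  proof -
    have "A' * B = four_block_mat ?e (0\<^sub>m 1 m) (0\<^sub>m m 1) (A3 * U)"
      unfolding block unfolding B_def
      by (subst mult_four_block_mat[of _ 1 1 _ m _ m _ _ 1 _ m]) (use U A3 in auto)
    moreover have "B * mat_diag n ((!) (e # es)) =
        four_block_mat ?e (0\<^sub>m 1 m) (0\<^sub>m m 1) (U * mat_diag m ((!) es))"
      unfolding dg unfolding B_def
      by (subst mult_four_block_mat[of _ 1 1 _ m _ m _ _ 1 _ m])
         (use U in \<open>auto simp: right_mult_zero_mat left_mult_zero_mat[of "mat_diag m ((!) es)" m m]\<close>)
    ultimately show ?thesis using U(4) by simp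
  qed
  show ?case
  proof (rule bexI[of _ "W * B"], intro conjI)
    have tWB: "transpose_mat (W * B) = transpose_mat B * W"
      using W B by (simp add: transpose_mult[of _ n n _ n])
    have "transpose_mat (W * B) * (W * B) = transpose_mat B * (W * W) * B"
      unfolding tWB using W(1) B by (simp add: assoc_mult_mat[of _ n n _ n _ n])
    then show "transpose_mat (W * B) * (W * B) = 1\<^sub>m n" using W B BtB by simp
    have "(W * B) * transpose_mat (W * B) = W * (B * transpose_mat B) * W"
      unfolding tWB using W(1) B by (simp add: assoc_mult_mat[of _ n n _ n _ n])
    then show "(W * B) * transpose_mat (W * B) = 1\<^sub>m n" using W B BBt by simp
    have "A * (W * B) = (W * W) * (A * (W * B))"
      using W A B by simp
    also have "\<dots> = W * (A' * B)"
      unfolding A'_def using W(1) A B by (simp add: assoc_mult_mat[of _ n n _ n _ n])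
    also have "\<dots> = W * B * mat_diag n ((!) (e # es))"
      unfolding A'B using W(1) B by (simp add: assoc_mult_mat[of _ n n _ n _ n])
    finally show "A * (W * B) = W * B * mat_diag n ((!) (e # es))" .
  qed (use W B in auto)
qed

text \<open>The polynomial splits over the complex numbers. For an eigenvector \<open>u\<close> to
  the root \<open>z\<close>, the Hermitian form \<open>S\<close> of the matrix at \<open>u\<close>
  equals its own conjugate and also \<open>z\<close> times the squared length of \<open>u\<close>,
  so \<open>z\<close> is real. The factorization descends because the embedding of real into complex
  polynomials is injective.\<close>

lemma real_symmetric_char_poly_splits:
  fixes A :: "real mat"
  assumes A: "A \<in> carrier_mat n n" and sym: "transpose_mat A = A"
  obtains es where "char_poly A = (\<Prod>e\<leftarrow>es. [:- e, 1:])" "length es = n"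
proof -
  let ?A = "map_mat complex_of_real A"
  have cA: "?A \<in> carrier_mat n n" using A by simp
  obtain zs where zs: "char_poly ?A = (\<Prod>z\<leftarrow>zs. [:- z, 1:])" "length zs = n"
    using char_poly_factorized[OF cA] by auto
  have Aij: "A $$ (i, j) = A $$ (j, i)" if "i < n" "j < n" for i j
    using arg_cong[OF sym, of "\<lambda>M. M $$ (i, j)"] that A by simp
  have real: "z = complex_of_real (Re z)" if z: "z \<in> set zs" for z
  proof -
    have "poly (char_poly ?A) z = 0"
      unfolding zs(1) by (simp add: poly_prod_list_zero_iff) (use z in force)
    then have "eigenvalue ?A z" using eigenvalue_root_char_poly[OF cA] by simp
    then obtain u where u: "u \<in> carrier_vec n" "u \<noteq> 0\<^sub>v n" "?A *\<^sub>v u = z \<cdot>\<^sub>v u"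
      using A unfolding eigenvalue_def eigenvector_def by auto
    define S where "S = (\<Sum>i<n. \<Sum>j<n. cnj (u $ i) * (A $$ (i, j) * u $ j))"
    have row: "(\<Sum>j<n. A $$ (i, j) * u $ j) = z * u $ i" if "i < n" for i
      using arg_cong[OF u(3), of "\<lambda>v. v $ i"] that u(1) A
      by (simp add: scalar_prod_def lessThan_atLeast0)
    have "S = (\<Sum>i<n. cnj (u $ i) * (z * u $ i))"
      unfolding S_def sum_distrib_left[symmetric] by (rule sum.cong) (auto simp: row)
    also have "\<dots> = z * (\<Sum>i<n. (cmod (u $ i))\<^sup>2)"
      by (simp add: sum_distrib_left complex_norm_square mult_ac del: of_real_power)
    finally have S: "S = z * (\<Sum>i<n. (cmod (u $ i))\<^sup>2)" .
    have "cnj S = (\<Sum>i<n. \<Sum>j<n. u $ i * (A $$ (i, j) * cnj (u $ j)))"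
      by (simp add: S_def)
    also have "\<dots> = (\<Sum>j<n. \<Sum>i<n. u $ i * (A $$ (i, j) * cnj (u $ j)))"
      by (rule sum.swap)
    also have "\<dots> = S"
      unfolding S_def by (intro sum.cong refl) (auto simp: Aij mult_ac)
    finally have "cnj S = S" .
    moreover obtain i where "i < n" "u $ i \<noteq> 0"
      using u(1,2) by (metis eq_vecI carrier_vecD index_zero_vec(1,2))
    then have "(\<Sum>i<n. (cmod (u $ i))\<^sup>2) > 0"
      by (intro sum_pos2[of _ i]) auto
    ultimately have "cnj z = z"
      unfolding S by (simp del: of_real_sum of_real_power)
    then show ?thesis by (metis Reals_cnj_iff of_real_Re)
  qed
  define es where "es = map Re zs"
  interpret P: map_poly_inj_comm_ring_hom complex_of_real ..
  have "map_poly complex_of_real (\<Prod>e\<leftarrow>es. [:- e, 1:]) = (\<Prod>z\<leftarrow>zs. [:- z, 1:])"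
    unfolding es_def P.hom_prod_list map_map
    by (rule arg_cong[of _ _ prod_list], rule map_cong[OF refl]) (use real in auto)
  also have "\<dots> = map_poly complex_of_real (char_poly A)"
    unfolding zs(1)[symmetric] by (rule of_real_hom.char_poly_hom[OF A])
  finally have "char_poly A = (\<Prod>e\<leftarrow>es. [:- e, 1:])" by simp
  moreover have "length es = n" using zs(2) by (simp add: es_def)
  ultimately show thesis by (rule that)
qed

section \<open>Spectral gaps of reversible kernels\<close>

definition inner_on :: "'s set \<Rightarrow> ('s \<Rightarrow> real) \<Rightarrow> ('s \<Rightarrow> real) \<Rightarrow> ('s \<Rightarrow> real) \<Rightarrow> real" where
  "inner_on \<Omega> \<pi> f g = (\<Sum>x\<in>\<Omega>. \<pi> x * f x * g x)"

definition kernel_op :: "'s set \<Rightarrow> ('s \<Rightarrow> 's \<Rightarrow> real) \<Rightarrow> ('s \<Rightarrow> real) \<Rightarrow> 's \<Rightarrow> real" where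
  "kernel_op \<Omega> K f x = (\<Sum>y\<in>\<Omega>. K x y * f y)"

lemma inner_on_commute: "inner_on \<Omega> \<pi> f g = inner_on \<Omega> \<pi> g f"
  by (simp add: inner_on_def mult_ac)

lemma inner_on_cong:
  assumes "\<And>x. x \<in> \<Omega> \<Longrightarrow> f x = f' x" "\<And>x. x \<in> \<Omega> \<Longrightarrow> g x = g' x"
  shows "inner_on \<Omega> \<pi> f g = inner_on \<Omega> \<pi> f' g'"
  unfolding inner_on_def by (rule sum.cong) (use assms in auto)

lemma inner_on_scale_right: "inner_on \<Omega> \<pi> f (\<lambda>x. c * g x) = c * inner_on \<Omega> \<pi> f g"
  by (simp add: inner_on_def sum_distrib_left mult_ac)

lemma inner_on_scale_left: "inner_on \<Omega> \<pi> (\<lambda>x. c * f x) g = c * inner_on \<Omega> \<pi> f g"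
  by (simp add: inner_on_def sum_distrib_left mult_ac)

lemma inner_on_diff_left:
  "inner_on \<Omega> \<pi> (\<lambda>x. f x - g x) h = inner_on \<Omega> \<pi> f h - inner_on \<Omega> \<pi> g h"
  by (simp add: inner_on_def sum_subtractf algebra_simps)

lemma inner_on_self_nonneg:
  assumes "\<And>x. x \<in> \<Omega> \<Longrightarrow> \<pi> x \<ge> 0"
  shows "inner_on \<Omega> \<pi> f f \<ge> 0"
  unfolding inner_on_def by (rule sum_nonneg) (simp add: assms mult.assoc)

lemma kernel_op_self_adjoint:
  assumes "reversible \<Omega> \<pi> K"
  shows "inner_on \<Omega> \<pi> f (kernel_op \<Omega> K g) = inner_on \<Omega> \<pi> (kernel_op \<Omega> K f) g"
proof -
  have "inner_on \<Omega> \<pi> f (kernel_op \<Omega> K g) = (\<Sum>x\<in>\<Omega>. \<Sum>y\<in>\<Omega>. (\<pi> x * K x y) * f x * g y)"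
    by (simp add: inner_on_def kernel_op_def sum_distrib_left mult_ac)
  also have "\<dots> = (\<Sum>x\<in>\<Omega>. \<Sum>y\<in>\<Omega>. (\<pi> y * K y x) * f x * g y)"
    using assms by (intro sum.cong refl) (simp add: reversible_def)
  also have "\<dots> = (\<Sum>y\<in>\<Omega>. \<Sum>x\<in>\<Omega>. (\<pi> y * K y x) * f x * g y)"
    by (rule sum.swap)
  also have "\<dots> = inner_on \<Omega> \<pi> (kernel_op \<Omega> K f) g"
    by (simp add: inner_on_def kernel_op_def sum_distrib_left sum_distrib_right mult_ac)
  finally show ?thesis .
qed

text \<open>This lets a splitting with the roots in any order be replaced by the decreasing list on
  which \<open>spectral_gap\<close> is built; both lists have the same multiset of roots.\<close>

lemma eigenvalues_desc_split:
  assumes "char_poly M = (\<Prod>e\<leftarrow>es. [:- e, 1:])"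
  shows "mset (eigenvalues_desc M) = mset es"
    and "char_poly M = (\<Prod>e\<leftarrow>eigenvalues_desc M. [:- e, 1:])"
proof -
  have "proots (\<Prod>e\<leftarrow>xs. [:- e, 1:]) = mset xs" for xs :: "real list"
  proof (induction xs)
    case (Cons a xs)
    have "(\<Prod>e\<leftarrow>xs. [:- e, 1:]) \<noteq> 0" by (auto simp: prod_list_zero_iff)
    then have "proots ([:- a, 1:] * (\<Prod>e\<leftarrow>xs. [:- e, 1:])) = {#a#} + mset xs"
      using Cons by (subst proots_mult) auto
    then show ?case by simp
  qed simp
  then show *: "mset (eigenvalues_desc M) = mset es"
    by (simp add: eigenvalues_desc_def assms)
  have "(\<Prod>e\<leftarrow>xs. [:- e, 1:]) = prod_mset (image_mset (\<lambda>e. [:- e, 1:]) (mset xs))"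
    for xs :: "real list"
    by (simp flip: prod_mset_prod_list)
  then show "char_poly M = (\<Prod>e\<leftarrow>eigenvalues_desc M. [:- e, 1:])"
    using * assms by metis
qed

lemma eigenvalues_desc_antimono:
  assumes "i \<le> j" "j < length (eigenvalues_desc M)"
  shows "eigenvalues_desc M ! j \<le> eigenvalues_desc M ! i"
proof -
  have "sorted (rev (eigenvalues_desc M))"
    by (simp add: eigenvalues_desc_def)
  then show ?thesis using assms by (simp add: sorted_rev_nth_mono)
qed

text \<open>Conjugation by the diagonal matrix of \<open>sqrt (\<pi> x)\<close> makes the kernel
  symmetric, by detailed balance, and keeps the characteristic polynomial. Dividing the columns of
  an orthogonal diagonalization by \<open>sqrt (\<pi> x)\<close> gives eigenfunctions that are
  orthonormal for the weighted inner product; orthogonality of the rows gives Parseval's identity,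
  the last claim.\<close>

lemma reversible_eigenbasis:
  fixes \<Omega> :: "'s set"
  assumes fin: "finite \<Omega>" and pos: "\<And>x. x \<in> \<Omega> \<Longrightarrow> \<pi> x > 0" and rev: "reversible \<Omega> \<pi> K"
  obtains \<phi> :: "nat \<Rightarrow> 's \<Rightarrow> real"
  where "length (eigenvalues_desc (kernel_mat \<Omega> K)) = card \<Omega>"
    and "\<And>i x. i < card \<Omega> \<Longrightarrow> x \<in> \<Omega> \<Longrightarrow>
      kernel_op \<Omega> K (\<phi> i) x = eigenvalues_desc (kernel_mat \<Omega> K) ! i * \<phi> i x"
    and "\<And>i j. i < card \<Omega> \<Longrightarrow> j < card \<Omega> \<Longrightarrow> inner_on \<Omega> \<pi> (\<phi> i) (\<phi> j) = of_bool (i = j)"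
    and "\<And>f g. inner_on \<Omega> \<pi> f g = (\<Sum>i<card \<Omega>. inner_on \<Omega> \<pi> f (\<phi> i) * inner_on \<Omega> \<pi> g (\<phi> i))"
proof -
  define n where "n = card \<Omega>"
  define r where "r = from_nat_into \<Omega>"
  have bij: "bij_betw r {..<n} \<Omega>"
    unfolding r_def n_def by (rule bij_betw_from_nat_into_finite[OF fin])
  then have r: "r i \<in> \<Omega>" if "i < n" for i using that by (auto simp: bij_betw_def)
  note sum_r = sum.reindex_bij_betw[OF bij, symmetric]
  define s where "s i = sqrt (\<pi> (r i))" for i
  have s: "s i > 0" "s i * s i = \<pi> (r i)" if "i < n" for i
    using pos[OF r[OF that]] by (auto simp: s_def)
  have s0: "s i \<noteq> 0" if "i < n" for i using s(1)[OF that] by simp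
  define M where "M = kernel_mat \<Omega> K"
  have M: "M \<in> carrier_mat n n" by (simp add: M_def kernel_mat_def n_def)
  have Mij: "M $$ (i, j) = K (r i) (r j)" if "i < n" "j < n" for i j
    using that by (simp add: M_def kernel_mat_def n_def r_def)
  define D where "D = mat_diag n s"
  define D' where "D' = mat_diag n (\<lambda>i. 1 / s i)"
  have D: "D \<in> carrier_mat n n" "D' \<in> carrier_mat n n" by (simp_all add: D_def D'_def)
  have DD: "D * D' = 1\<^sub>m n" "D' * D = 1\<^sub>m n"
    unfolding D_def D'_def mat_diag_diag using s
    by (auto intro!: eq_matI simp: mat_diag_def) (metis less_irrefl)+
  define A where "A = D * M * D'"
  have A: "A \<in> carrier_mat n n" using D M by (simp add: A_def)
  have Aij: "A $$ (i, j) = s i * K (r i) (r j) / s j" if "i < n" "j < n" for i j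
    unfolding A_def D_def D'_def using M that
    by (simp add: mat_diag_mult_left[OF M] mat_diag_mult_right[of _ n n] Mij)
  have "transpose_mat A = A"
  proof (rule eq_matI)
    fix i j assume "i < dim_row A" "j < dim_col A"
    then have ij: "i < n" "j < n" using A by auto
    have "s i * s i * K (r i) (r j) = s j * s j * K (r j) (r i)"
      using rev r ij s by (simp add: reversible_def)
    then show "transpose_mat A $$ (i, j) = A $$ (i, j)"
      using ij A s(1)[OF ij(1)] s(1)[OF ij(2)] by (simp add: Aij field_simps)
  qed (use A in auto)
  note sym = this
  have "similar_mat A M"
    unfolding A_def by (rule similar_matI[of _ _ D D' n]) (use D M DD in auto)
  then have cp: "char_poly M = char_poly A" using char_poly_similar by metis
  define es where "es = eigenvalues_desc M"
  obtain es' where es': "char_poly A = (\<Prod>e\<leftarrow>es'. [:- e, 1:])" "length es' = n"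
    using real_symmetric_char_poly_splits[OF A sym] .
  have cpes: "char_poly A = (\<Prod>e\<leftarrow>es. [:- e, 1:])"
    using eigenvalues_desc_split(2)[of M es'] es' cp by (simp add: es_def)
  have "length es = n"
    using eigenvalues_desc_split(1)[of M es'] es' cp by (metis es_def size_mset)
  obtain W where W: "W \<in> carrier_mat n n" "transpose_mat W * W = 1\<^sub>m n"
      "W * transpose_mat W = 1\<^sub>m n" "A * W = W * mat_diag n ((!) es)"
    using real_symmetric_diagonalization[OF A sym cpes] by blast
  have col_orth: "(\<Sum>k<n. W $$ (k, i) * W $$ (k, j)) = of_bool (i = j)" if "i < n" "j < n" for i j
    using arg_cong[OF W(2), of "\<lambda>B. B $$ (i, j)"] that W(1)
    by (simp add: scalar_prod_def lessThan_atLeast0)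
  have row_orth: "(\<Sum>k<n. W $$ (i, k) * W $$ (j, k)) = of_bool (i = j)" if "i < n" "j < n" for i j
    using arg_cong[OF W(3), of "\<lambda>B. B $$ (i, j)"] that W(1)
    by (simp add: scalar_prod_def lessThan_atLeast0)
  have AW: "(\<Sum>k<n. A $$ (j, k) * W $$ (k, i)) = es ! i * W $$ (j, i)" if "i < n" "j < n" for i j
    using arg_cong[OF W(4), of "\<lambda>B. B $$ (j, i)"] that W(1) A
    by (simp add: scalar_prod_def lessThan_atLeast0 mat_diag_mult_right[of _ n n])
  define \<phi> where "\<phi> i x = W $$ (the_inv_into {..<n} r x, i) / sqrt (\<pi> x)" for i x
  have \<phi>: "\<phi> i (r j) = W $$ (j, i) / s j" if "j < n" for i j
    using that bij by (simp add: \<phi>_def s_def the_inv_into_f_f bij_betw_def)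
  have inner: "inner_on \<Omega> \<pi> f (\<phi> i) = (\<Sum>j<n. s j * f (r j) * W $$ (j, i))" for f i
    unfolding inner_on_def sum_r
    by (rule sum.cong) (use s in \<open>auto simp: \<phi> field_simps simp flip: s(2)\<close>)
  show thesis
  proof (rule that[of \<phi>], unfold M_def[symmetric] es_def[symmetric] n_def[symmetric])
    show "length es = n" by fact
    fix i j assume i: "i < n" and j: "j < n"
    show "inner_on \<Omega> \<pi> (\<phi> i) (\<phi> j) = of_bool (i = j)"
      unfolding inner col_orth[OF i j, symmetric]
      by (rule sum.cong) (auto simp: \<phi> s0)
  next
    fix i x assume i: "i < n" and "x \<in> \<Omega>"
    then obtain j where j: "j < n" "x = r j" using bij by (auto simp: bij_betw_def)
    have "kernel_op \<Omega> K (\<phi> i) x = (\<Sum>k<n. A $$ (j, k) * W $$ (k, i)) / s j"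
      unfolding kernel_op_def sum_r sum_divide_distrib j(2)
      by (rule sum.cong) (auto simp: \<phi> Aij s0 j(1))
    then show "kernel_op \<Omega> K (\<phi> i) x = es ! i * \<phi> i x"
      using AW[OF i j(1)] j by (simp add: \<phi>)
  next
    fix f g
    have "(\<Sum>i<n. inner_on \<Omega> \<pi> f (\<phi> i) * inner_on \<Omega> \<pi> g (\<phi> i)) =
      (\<Sum>i<n. \<Sum>j<n. \<Sum>k<n. (s j * f (r j)) * (s k * g (r k)) * (W $$ (j, i) * W $$ (k, i)))"
      unfolding inner sum_product by (intro sum.cong refl) (simp add: mult_ac)
    also have "\<dots> = (\<Sum>j<n. \<Sum>k<n. \<Sum>i<n. (s j * f (r j)) * (s k * g (r k)) * (W $$ (j, i) * W $$ (k, i)))"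
      by (subst sum.swap, rule sum.cong[OF refl], rule sum.swap)
    also have "\<dots> = (\<Sum>j<n. \<Sum>k<n. (s j * f (r j)) * (s k * g (r k)) * of_bool (j = k))"
      unfolding sum_distrib_left[symmetric] by (intro sum.cong refl) (simp add: row_orth)
    also have "\<dots> = (\<Sum>j<n. \<Sum>k<n. if k = j then (s j * s j) * f (r j) * g (r j) else 0)"
      by (intro sum.cong refl) auto
    also have "\<dots> = (\<Sum>j<n. \<pi> (r j) * f (r j) * g (r j))"
      by (rule sum.cong) (auto simp: s(2))
    also have "\<dots> = inner_on \<Omega> \<pi> f g" unfolding inner_on_def sum_r ..
    finally show "inner_on \<Omega> \<pi> f g = (\<Sum>i<n. inner_on \<Omega> \<pi> f (\<phi> i) * inner_on \<Omega> \<pi> g (\<phi> i))" ..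
  qed
qed

text \<open>The argument of Courant and Fischer: the span of the first two eigenfunctions contains a
  nonzero function of mean zero, and on this span the Rayleigh quotient is at least the second
  eigenvalue. Positive semidefiniteness makes the last eigenvalue nonnegative, so the maximum in
  \<open>spectral_gap\<close> is the second eigenvalue.\<close>

lemma spectral_gap_ge:
  assumes fin: "finite \<Omega>" and pos: "\<And>x. x \<in> \<Omega> \<Longrightarrow> \<pi> x > 0" and rev: "reversible \<Omega> \<pi> K"
    and card: "card \<Omega> \<ge> 2"
    and psd: "\<And>f. inner_on \<Omega> \<pi> f (kernel_op \<Omega> K f) \<ge> 0"
    and poincare: "\<And>f. inner_on \<Omega> \<pi> f (\<lambda>_. 1) = 0 \<Longrightarrow>
      c * inner_on \<Omega> \<pi> f f \<le> inner_on \<Omega> \<pi> f f - inner_on \<Omega> \<pi> f (kernel_op \<Omega> K f)"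
  shows "spectral_gap (kernel_mat \<Omega> K) \<ge> c"
proof -
  define es where "es = eigenvalues_desc (kernel_mat \<Omega> K)"
  define n where "n = card \<Omega>"
  obtain \<phi> where len: "length es = n"
    and eig: "\<And>i x. i < n \<Longrightarrow> x \<in> \<Omega> \<Longrightarrow> kernel_op \<Omega> K (\<phi> i) x = es ! i * \<phi> i x"
    and orth: "\<And>i j. i < n \<Longrightarrow> j < n \<Longrightarrow> inner_on \<Omega> \<pi> (\<phi> i) (\<phi> j) = of_bool (i = j)"
    unfolding es_def n_def using reversible_eigenbasis[OF fin pos rev] by metis
  have n: "n \<ge> 2" using card by (simp add: n_def)
  have quad: "inner_on \<Omega> \<pi> (\<phi> i) (kernel_op \<Omega> K (\<phi> i)) = es ! i" if "i < n" for i
  proof -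
    have "inner_on \<Omega> \<pi> (\<phi> i) (kernel_op \<Omega> K (\<phi> i)) = inner_on \<Omega> \<pi> (\<phi> i) (\<lambda>x. es ! i * \<phi> i x)"
      by (rule inner_on_cong) (use eig that in auto)
    then show ?thesis using orth that by (simp add: inner_on_scale_right)
  qed
  have anti: "es ! j \<le> es ! i" if "i \<le> j" "j < n" for i j
    using eigenvalues_desc_antimono that len unfolding es_def by blast
  define a where "a = inner_on \<Omega> \<pi> (\<phi> 0) (\<lambda>_. 1)"
  define b where "b = inner_on \<Omega> \<pi> (\<phi> 1) (\<lambda>_. 1)"
  have "es ! 1 \<le> 1 - c"
  \<comment> \<open>If the first eigenfunction itself has mean zero, the hypothesis bounds even the
    largest eigenvalue.\<close>
  proof (cases "a = 0")
    case True
    then have "c \<le> 1 - es ! 0"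
      using poincare[of "\<phi> 0"] quad[of 0] orth[of 0 0] n by (simp add: a_def)
    then show ?thesis using anti[of 0 1] n by simp
  next
    case False
    \<comment> \<open>The coefficients are chosen so that the means \<open>a\<close> and
      \<open>b\<close> of the two eigenfunctions cancel; \<open>f\<close> is nonzero because
      \<open>a\<close> is.\<close>
    define f where "f x = b * \<phi> 0 x - a * \<phi> 1 x" for x
    have inner_f: "inner_on \<Omega> \<pi> f g = b * inner_on \<Omega> \<pi> (\<phi> 0) g - a * inner_on \<Omega> \<pi> (\<phi> 1) g" for g
      unfolding f_def inner_on_diff_left inner_on_scale_left ..
    have "inner_on \<Omega> \<pi> f (\<lambda>_. 1) = 0"
      unfolding inner_f by (simp add: a_def b_def)
    note P = poincare[OF this]
    have f0: "inner_on \<Omega> \<pi> (\<phi> 0) f = b" "inner_on \<Omega> \<pi> (\<phi> 1) f = - a"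
      using n orth[of 0 0] orth[of 0 1] orth[of 1 0] orth[of 1 1]
      unfolding inner_on_commute[of _ _ _ f] inner_f by simp_all
    have ff: "inner_on \<Omega> \<pi> f f = b\<^sup>2 + a\<^sup>2"
      unfolding inner_f f0 by (simp add: power2_eq_square)
    have Kf: "kernel_op \<Omega> K f x = (b * es ! 0) * \<phi> 0 x - (a * es ! 1) * \<phi> 1 x" if "x \<in> \<Omega>" for x
    proof -
      have "kernel_op \<Omega> K f x = b * kernel_op \<Omega> K (\<phi> 0) x - a * kernel_op \<Omega> K (\<phi> 1) x"
        by (simp add: kernel_op_def f_def sum_distrib_left sum_subtractf algebra_simps)
      then show ?thesis using eig that n by simp
    qed
    have "inner_on \<Omega> \<pi> f (kernel_op \<Omega> K f) = inner_on \<Omega> \<pi> (kernel_op \<Omega> K f) f"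
      by (rule inner_on_commute)
    also have "\<dots> = inner_on \<Omega> \<pi> (\<lambda>x. (b * es ! 0) * \<phi> 0 x - (a * es ! 1) * \<phi> 1 x) f"
      by (rule inner_on_cong) (simp_all add: Kf)
    also have "\<dots> = es ! 0 * b\<^sup>2 + es ! 1 * a\<^sup>2"
      unfolding inner_on_diff_left inner_on_scale_left f0 by (simp add: power2_eq_square)
    finally have "c * (b\<^sup>2 + a\<^sup>2) \<le> b\<^sup>2 + a\<^sup>2 - (es ! 0 * b\<^sup>2 + es ! 1 * a\<^sup>2)"
      using P ff by simp
    moreover have "es ! 1 * b\<^sup>2 \<le> es ! 0 * b\<^sup>2"
      using anti[of 0 1] n by (intro mult_right_mono) auto
    ultimately have "es ! 1 * (b\<^sup>2 + a\<^sup>2) \<le> (1 - c) * (b\<^sup>2 + a\<^sup>2)"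
      by (simp add: algebra_simps)
    moreover have "b\<^sup>2 + a\<^sup>2 > 0" using False by (simp add: add_nonneg_pos)
    ultimately show ?thesis by simp
  qed
  moreover have "es ! (n - 1) \<le> es ! 1" "es ! (n - 1) \<ge> 0"
    using anti[of 1 "n - 1"] quad[of "n - 1"] psd[of "\<phi> (n - 1)"] n by simp_all
  ultimately show ?thesis
    by (simp add: spectral_gap_def kernel_mat_def flip: n_def) 
       (simp add: es_def n_def kernel_mat_def)
qed

text \<open>A converse of \<open>spectral_gap_ge\<close>: in the eigenbasis, the form of a function
  of mean zero is at most the second eigenvalue times its squared norm, because the component along
  a strictly larger first eigenvalue vanishes.\<close>

lemma spectral_gap_poincare:
  assumes fin: "finite \<Omega>" and pos: "\<And>x. x \<in> \<Omega> \<Longrightarrow> \<pi> x > 0" and rev: "reversible \<Omega> \<pi> K"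
    and card: "card \<Omega> \<ge> 2"
    and rows: "\<And>x. x \<in> \<Omega> \<Longrightarrow> (\<Sum>y\<in>\<Omega>. K x y) = 1"
    and psd: "\<And>f. inner_on \<Omega> \<pi> f (kernel_op \<Omega> K f) \<ge> 0"
    and contr: "\<And>f. inner_on \<Omega> \<pi> f (kernel_op \<Omega> K f) \<le> inner_on \<Omega> \<pi> f f"
  shows "0 \<le> spectral_gap (kernel_mat \<Omega> K)" "spectral_gap (kernel_mat \<Omega> K) \<le> 1"
    and "inner_on \<Omega> \<pi> h (\<lambda>_. 1) = 0 \<Longrightarrow> spectral_gap (kernel_mat \<Omega> K) * inner_on \<Omega> \<pi> h h
      \<le> inner_on \<Omega> \<pi> h h - inner_on \<Omega> \<pi> h (kernel_op \<Omega> K h)"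
proof -
  define es where "es = eigenvalues_desc (kernel_mat \<Omega> K)"
  define n where "n = card \<Omega>"
  obtain \<phi> where len: "length es = n"
    and eig: "\<And>i x. i < n \<Longrightarrow> x \<in> \<Omega> \<Longrightarrow> kernel_op \<Omega> K (\<phi> i) x = es ! i * \<phi> i x"
    and orth: "\<And>i j. i < n \<Longrightarrow> j < n \<Longrightarrow> inner_on \<Omega> \<pi> (\<phi> i) (\<phi> j) = of_bool (i = j)"
    and parseval: "\<And>f g. inner_on \<Omega> \<pi> f g = (\<Sum>i<n. inner_on \<Omega> \<pi> f (\<phi> i) * inner_on \<Omega> \<pi> g (\<phi> i))"
    by (rule reversible_eigenbasis[OF fin pos rev, folded es_def n_def]) (assumption, rule that)
  have n: "n \<ge> 2" using card by (simp add: n_def)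
  have coeff: "inner_on \<Omega> \<pi> (kernel_op \<Omega> K f) (\<phi> i) = es ! i * inner_on \<Omega> \<pi> f (\<phi> i)"
    if "i < n" for f i
  proof -
    have "inner_on \<Omega> \<pi> (kernel_op \<Omega> K f) (\<phi> i) = inner_on \<Omega> \<pi> f (kernel_op \<Omega> K (\<phi> i))"
      by (rule kernel_op_self_adjoint[OF rev, symmetric])
    also have "\<dots> = inner_on \<Omega> \<pi> f (\<lambda>x. es ! i * \<phi> i x)"
      by (rule inner_on_cong) (use eig that in auto)
    finally show ?thesis by (simp add: inner_on_scale_right)
  qed
  have es01: "0 \<le> es ! i" "es ! i \<le> 1" if "i < n" for i
    using psd[of "\<phi> i"] contr[of "\<phi> i"] coeff[OF that, of "\<phi> i"] orth[OF that that]
    by (simp_all add: inner_on_commute[of _ _ "\<phi> i" "kernel_op _ _ _"])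
  have anti: "es ! j \<le> es ! i" if "i \<le> j" "j < n" for i j
    using eigenvalues_desc_antimono that len unfolding es_def by blast
  have gap: "spectral_gap (kernel_mat \<Omega> K) = 1 - es ! 1"
    using anti[of 1 "n - 1"] es01(1)[of "n - 1"] n
    by (simp add: spectral_gap_def flip: es_def) (simp add: kernel_mat_def n_def)
  show "0 \<le> spectral_gap (kernel_mat \<Omega> K)" "spectral_gap (kernel_mat \<Omega> K) \<le> 1"
    unfolding gap using es01[of 1] n by auto
  assume h: "inner_on \<Omega> \<pi> h (\<lambda>_. 1) = 0"
  have top: "es ! i * (inner_on \<Omega> \<pi> h (\<phi> i))\<^sup>2 \<le> es ! 1 * (inner_on \<Omega> \<pi> h (\<phi> i))\<^sup>2" if i: "i < n" for i
  \<comment> \<open>If the second eigenvalue is 1, no eigenvalue exceeds it. Only the first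
    coefficient in the presence of a second eigenvalue below 1 needs an argument.\<close>
  proof (cases "i = 0 \<and> es ! 1 < 1")
    case False
    then have "es ! i \<le> es ! 1"
      using anti[of 1 i] es01(2)[of i] i n by (cases "i = 0") auto
    then show ?thesis by (intro mult_right_mono) auto
  next
    case True
    \<comment> \<open>The kernel fixes the constant function, so its coefficients \<open>a j\<close>
      vanish wherever the eigenvalue is not 1. Hence it is a multiple of \<open>\<phi> 0\<close>,
      and mean zero means orthogonality to \<open>\<phi> 0\<close>.\<close>
    define a where "a j = inner_on \<Omega> \<pi> (\<lambda>_. 1) (\<phi> j)" for j
    have "a j = es ! j * a j" if "j < n" for j
    proof -
      have "inner_on \<Omega> \<pi> (kernel_op \<Omega> K (\<lambda>_. 1)) (\<phi> j) = a j"
        unfolding a_def by (rule inner_on_cong) (simp_all add: kernel_op_def rows)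
      then show ?thesis using coeff[OF that, of "\<lambda>_. 1"] by (simp add: a_def)
    qed
    moreover have "es ! j \<noteq> 1" if "j < n" "j > 0" for j
      using anti[of 1 j] that True by auto
    ultimately have a0: "a j = 0" if "j < n" "j > 0" for j using that by force
    have "inner_on \<Omega> \<pi> f (\<lambda>_. 1) = inner_on \<Omega> \<pi> f (\<phi> 0) * a 0" for f
    proof -
      have "inner_on \<Omega> \<pi> f (\<lambda>_. 1) = (\<Sum>i<n. if i = 0 then inner_on \<Omega> \<pi> f (\<phi> 0) * a 0 else 0)"
        unfolding parseval[of f "\<lambda>_. 1"] a_def[symmetric] by (rule sum.cong) (auto simp: a0)
      then show ?thesis using n by simp
    qed
    note const = this
    have "\<Omega> \<noteq> {}" using card by auto
    then have "inner_on \<Omega> \<pi> (\<lambda>_. 1) (\<lambda>_. 1) > 0"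
      unfolding inner_on_def using fin pos by (intro sum_pos) auto
    then have "a 0 \<noteq> 0" unfolding const by auto
    then have "inner_on \<Omega> \<pi> h (\<phi> 0) = 0" using h unfolding const by simp
    then show ?thesis using True by simp
  qed
  have "inner_on \<Omega> \<pi> h (kernel_op \<Omega> K h) = (\<Sum>i<n. es ! i * (inner_on \<Omega> \<pi> h (\<phi> i))\<^sup>2)"
    unfolding parseval[of h "kernel_op \<Omega> K h"]
    by (rule sum.cong) (auto simp: coeff power2_eq_square)
  also have "\<dots> \<le> (\<Sum>i<n. es ! 1 * (inner_on \<Omega> \<pi> h (\<phi> i))\<^sup>2)"
    by (rule sum_mono) (use top in auto)
  also have "\<dots> = es ! 1 * inner_on \<Omega> \<pi> h h"
    unfolding parseval[of h h] by (simp add: sum_distrib_left power2_eq_square)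
  finally show "spectral_gap (kernel_mat \<Omega> K) * inner_on \<Omega> \<pi> h h
      \<le> inner_on \<Omega> \<pi> h h - inner_on \<Omega> \<pi> h (kernel_op \<Omega> K h)"
    unfolding gap by (simp add: algebra_simps)
qed

text \<open>Cauchy-Schwarz with weights, obtained by expanding the nonnegative sum of
  \<open>p x * (P * f x - M)\<^sup>2\<close>.\<close>

lemma weighted_sum_square_le:
  fixes p f :: "'s \<Rightarrow> real"
  assumes fin: "finite S" and p: "\<And>x. x \<in> S \<Longrightarrow> p x \<ge> 0"
  shows "(\<Sum>x\<in>S. p x * f x)\<^sup>2 \<le> sum p S * (\<Sum>x\<in>S. p x * (f x)\<^sup>2)"
proof (cases "sum p S = 0")
  case True
  then have "p x = 0" if "x \<in> S" for x
    using sum_nonneg_eq_0_iff[of S p] fin p that by simp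
  then show ?thesis by simp
next
  case False
  define P where "P = sum p S"
  define M where "M = (\<Sum>x\<in>S. p x * f x)"
  define Q where "Q = (\<Sum>x\<in>S. p x * (f x)\<^sup>2)"
  have P: "P > 0" using False sum_nonneg[of S p] p by (force simp: P_def)
  have "0 \<le> (\<Sum>x\<in>S. p x * (P * f x - M)\<^sup>2)"
    by (rule sum_nonneg) (simp add: p)
  also have "\<dots> = (\<Sum>x\<in>S. P\<^sup>2 * (p x * (f x)\<^sup>2) - 2 * P * M * (p x * f x) + M\<^sup>2 * p x)"
    by (rule sum.cong) (auto simp: power2_eq_square algebra_simps)
  also have "\<dots> = P\<^sup>2 * Q - 2 * P * M * M + M\<^sup>2 * P"
    by (simp add: sum.distrib sum_subtractf flip: sum_distrib_left P_def Q_def M_def)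
  also have "\<dots> = P * (P * Q - M\<^sup>2)" by (simp add: power2_eq_square algebra_simps)
  finally show ?thesis
    using P by (simp add: zero_le_mult_iff flip: P_def Q_def M_def)
qed

lemma sum_square_le_card:
  fixes f :: "'s \<Rightarrow> real"
  assumes "finite S"
  shows "(\<Sum>x\<in>S. f x)\<^sup>2 \<le> card S * (\<Sum>x\<in>S. (f x)\<^sup>2)"
  using weighted_sum_square_le[OF assms, of "\<lambda>_. 1" f] by simp

section \<open>The square of a reversible kernel\<close>

definition kernel_square :: "'s set \<Rightarrow> ('s \<Rightarrow> 's \<Rightarrow> real) \<Rightarrow> 's \<Rightarrow> 's \<Rightarrow> real" where
  "kernel_square \<Omega> K x y = (\<Sum>z\<in>\<Omega>. K x z * K z y)"

text \<open>Carries the matrix power over to a kernel on \<open>\<Omega>\<close>, the setting of the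
  spectral lemmas.\<close>

lemma kernel_mat_square:
  assumes "finite \<Omega>"
  shows "kernel_mat \<Omega> K ^\<^sub>m 2 = kernel_mat \<Omega> (kernel_square \<Omega> K)"
proof -
  let ?M = "kernel_mat \<Omega> K"
  have M: "?M \<in> carrier_mat (card \<Omega>) (card \<Omega>)" by (simp add: kernel_mat_def)
  have "?M ^\<^sub>m 2 = ?M * ?M" using M by (simp add: numeral_2_eq_2)
  also have "\<dots> = kernel_mat \<Omega> (kernel_square \<Omega> K)"
  proof (rule eq_matI)
    fix i j assume "i < dim_row (kernel_mat \<Omega> (kernel_square \<Omega> K))"
      "j < dim_col (kernel_mat \<Omega> (kernel_square \<Omega> K))"
    then show "(?M * ?M) $$ (i, j) = kernel_mat \<Omega> (kernel_square \<Omega> K) $$ (i, j)"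
      by (simp add: kernel_mat_def scalar_prod_def kernel_square_def atLeast0LessThan
          sum.reindex_bij_betw[OF bij_betw_from_nat_into_finite[OF assms],
            of "\<lambda>z. K (from_nat_into \<Omega> i) z * K z (from_nat_into \<Omega> j)"])
  qed (simp_all add: kernel_mat_def)
  finally show ?thesis .
qed

lemma kernel_op_square: "kernel_op \<Omega> (kernel_square \<Omega> K) f = kernel_op \<Omega> K (kernel_op \<Omega> K f)"
proof
  fix x
  have "kernel_op \<Omega> (kernel_square \<Omega> K) f x = (\<Sum>y\<in>\<Omega>. \<Sum>z\<in>\<Omega>. K x z * (K z y * f y))"
    by (simp add: kernel_op_def kernel_square_def sum_distrib_right mult.assoc)
  also have "\<dots> = (\<Sum>z\<in>\<Omega>. \<Sum>y\<in>\<Omega>. K x z * (K z y * f y))" by (rule sum.swap)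
  finally show "kernel_op \<Omega> (kernel_square \<Omega> K) f x = kernel_op \<Omega> K (kernel_op \<Omega> K f) x"
    by (simp add: kernel_op_def sum_distrib_left)
qed

lemma reversible_kernel_square:
  assumes "reversible \<Omega> \<pi> K"
  shows "reversible \<Omega> \<pi> (kernel_square \<Omega> K)"
  unfolding reversible_def kernel_square_def sum_distrib_left
proof (intro ballI)
  fix x y assume xy: "x \<in> \<Omega>" "y \<in> \<Omega>"
  show "(\<Sum>z\<in>\<Omega>. \<pi> x * (K x z * K z y)) = (\<Sum>z\<in>\<Omega>. \<pi> y * (K y z * K z x))"
  proof (rule sum.cong[OF refl])
    fix z assume z: "z \<in> \<Omega>"
    have "\<pi> x * K x z = \<pi> z * K z x" "\<pi> z * K z y = \<pi> y * K y z"
      using assms xy z by (auto simp: reversible_def)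
    then have "\<pi> x * K x z * K z y = \<pi> y * K y z * K z x"
      by (metis mult.assoc mult.commute)
    then show "\<pi> x * (K x z * K z y) = \<pi> y * (K y z * K z x)" by (simp add: mult.assoc)
  qed
qed

text \<open>Cauchy-Schwarz in each row bounds the square of an average by the average of the
  squares; by reversibility and the row sums, \<open>\<pi>\<close> is stationary, which removes the
  kernel.\<close>

lemma kernel_op_contraction:
  assumes fin: "finite \<Omega>" and pos: "\<And>x. x \<in> \<Omega> \<Longrightarrow> \<pi> x \<ge> 0" and rev: "reversible \<Omega> \<pi> K"
    and K: "\<And>x y. x \<in> \<Omega> \<Longrightarrow> y \<in> \<Omega> \<Longrightarrow> K x y \<ge> 0"
    and rows: "\<And>x. x \<in> \<Omega> \<Longrightarrow> (\<Sum>y\<in>\<Omega>. K x y) = 1"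
  shows "inner_on \<Omega> \<pi> (kernel_op \<Omega> K f) (kernel_op \<Omega> K f) \<le> inner_on \<Omega> \<pi> f f"
proof -
  have "inner_on \<Omega> \<pi> (kernel_op \<Omega> K f) (kernel_op \<Omega> K f) \<le> (\<Sum>x\<in>\<Omega>. \<pi> x * (\<Sum>y\<in>\<Omega>. K x y * (f y)\<^sup>2))"
    unfolding inner_on_def mult.assoc power2_eq_square[symmetric]
  proof (intro sum_mono mult_left_mono pos)
    fix x assume "x \<in> \<Omega>"
    then show "(kernel_op \<Omega> K f x)\<^sup>2 \<le> (\<Sum>y\<in>\<Omega>. K x y * (f y)\<^sup>2)"
      using weighted_sum_square_le[of \<Omega> "K x" f] fin K rows by (simp add: kernel_op_def)
  qed
  also have "\<dots> = (\<Sum>x\<in>\<Omega>. \<Sum>y\<in>\<Omega>. \<pi> x * K x y * (f y)\<^sup>2)"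
    by (simp add: sum_distrib_left mult.assoc)
  also have "\<dots> = (\<Sum>x\<in>\<Omega>. \<Sum>y\<in>\<Omega>. \<pi> y * (f y)\<^sup>2 * K y x)"
    using rev by (intro sum.cong refl) (simp add: reversible_def mult_ac)
  also have "\<dots> = (\<Sum>y\<in>\<Omega>. \<Sum>x\<in>\<Omega>. \<pi> y * (f y)\<^sup>2 * K y x)" by (rule sum.swap)
  also have "\<dots> = inner_on \<Omega> \<pi> f f"
    unfolding inner_on_def sum_distrib_left[symmetric]
    by (rule sum.cong) (auto simp: rows power2_eq_square)
  finally show ?thesis .
qed

text \<open>The form of the squared kernel at \<open>f\<close> is the squared norm of
  \<open>kernel_op \<Omega> K f\<close>. It is therefore nonnegative and contracting even if
  \<open>K\<close> has negative eigenvalues, and \<open>spectral_gap_poincare\<close>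
  applies.\<close>

lemma spectral_gap_kernel_square:
  assumes fin: "finite \<Omega>" and pos: "\<And>x. x \<in> \<Omega> \<Longrightarrow> \<pi> x > 0" and rev: "reversible \<Omega> \<pi> K"
    and card: "card \<Omega> \<ge> 2"
    and K: "\<And>x y. x \<in> \<Omega> \<Longrightarrow> y \<in> \<Omega> \<Longrightarrow> K x y \<ge> 0"
    and rows: "\<And>x. x \<in> \<Omega> \<Longrightarrow> (\<Sum>y\<in>\<Omega>. K x y) = 1"
  shows "0 \<le> spectral_gap (kernel_mat \<Omega> K ^\<^sub>m 2)" "spectral_gap (kernel_mat \<Omega> K ^\<^sub>m 2) \<le> 1"
    and "inner_on \<Omega> \<pi> h (\<lambda>_. 1) = 0 \<Longrightarrow> spectral_gap (kernel_mat \<Omega> K ^\<^sub>m 2) * inner_on \<Omega> \<pi> h h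
      \<le> 2 * (inner_on \<Omega> \<pi> h h - inner_on \<Omega> \<pi> h (kernel_op \<Omega> K h))"
proof -
  let ?K2 = "kernel_square \<Omega> K"
  note rev2 = reversible_kernel_square[OF rev]
  have quad: "inner_on \<Omega> \<pi> f (kernel_op \<Omega> ?K2 f) = inner_on \<Omega> \<pi> (kernel_op \<Omega> K f) (kernel_op \<Omega> K f)" for f
    unfolding kernel_op_square by (rule kernel_op_self_adjoint[OF rev])
  have rows2: "(\<Sum>y\<in>\<Omega>. ?K2 x y) = 1" if "x \<in> \<Omega>" for x
  proof -
    have "(\<Sum>y\<in>\<Omega>. ?K2 x y) = (\<Sum>z\<in>\<Omega>. \<Sum>y\<in>\<Omega>. K x z * K z y)"
      unfolding kernel_square_def by (rule sum.swap)
    also have "\<dots> = (\<Sum>z\<in>\<Omega>. K x z)"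
      unfolding sum_distrib_left[symmetric] by (rule sum.cong) (simp_all add: rows)
    finally show ?thesis using rows that by simp
  qed
  have nonneg: "inner_on \<Omega> \<pi> f f \<ge> 0" for f
    by (rule inner_on_self_nonneg) (simp add: pos less_imp_le)
  have psd: "0 \<le> inner_on \<Omega> \<pi> f (kernel_op \<Omega> ?K2 f)" for f
    unfolding quad by (rule nonneg)
  have contr: "inner_on \<Omega> \<pi> f (kernel_op \<Omega> ?K2 f) \<le> inner_on \<Omega> \<pi> f f" for f
    unfolding quad by (rule kernel_op_contraction[OF fin _ rev K rows]) (simp_all add: pos less_imp_le)
  note gap = spectral_gap_poincare[OF fin pos rev2 card rows2 psd contr, folded kernel_mat_square[OF fin]]
  show "0 \<le> spectral_gap (kernel_mat \<Omega> K ^\<^sub>m 2)" "spectral_gap (kernel_mat \<Omega> K ^\<^sub>m 2) \<le> 1"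
    using gap(1,2) by blast+
  assume h: "inner_on \<Omega> \<pi> h (\<lambda>_. 1) = 0"
  let ?Kh = "kernel_op \<Omega> K h"
  have "0 \<le> inner_on \<Omega> \<pi> (\<lambda>x. h x - ?Kh x) (\<lambda>x. h x - ?Kh x)" by (rule nonneg)
  also have "\<dots> = inner_on \<Omega> \<pi> h h - 2 * inner_on \<Omega> \<pi> h ?Kh + inner_on \<Omega> \<pi> ?Kh ?Kh"
    by (simp add: inner_on_def sum.distrib sum_subtractf sum_distrib_left algebra_simps)
  finally show "spectral_gap (kernel_mat \<Omega> K ^\<^sub>m 2) * inner_on \<Omega> \<pi> h h
      \<le> 2 * (inner_on \<Omega> \<pi> h h - inner_on \<Omega> \<pi> h (kernel_op \<Omega> K h))"
    using gap(3)[OF _ _ h] unfolding quad by simp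
qed

section \<open>Recolouring a single vertex\<close>

definition recolor_avg :: "nat \<Rightarrow> 'a \<Rightarrow> ('a config \<Rightarrow> real) \<Rightarrow> 'a config \<Rightarrow> real" where
  "recolor_avg q u f \<sigma> = (\<Sum>l\<in>{1..q}. f (\<sigma>(u := l))) / q"

text \<open>The current colour at \<open>u\<close> must itself be admissible, so that
  \<open>S\<close> is a disjoint union of full classes of \<open>q\<close> configurations that
  differ only at \<open>u\<close>.\<close>

definition recolor_closed :: "nat \<Rightarrow> 'a \<Rightarrow> 'a config set \<Rightarrow> bool" where
  "recolor_closed q u S \<longleftrightarrow> (\<forall>\<sigma>\<in>S. \<sigma> u \<in> {1..q} \<and> (\<forall>l\<in>{1..q}. \<sigma>(u := l) \<in> S))"

lemma recolor_avg_upd [simp]: "recolor_avg q u f (\<sigma>(u := l)) = recolor_avg q u f \<sigma>"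
  by (simp add: recolor_avg_def)

text \<open>The map that recolours \<open>u\<close> with \<open>l\<close> and keeps the old colour
  as the new second component is an involution on the pairs \<open>(\<sigma>, l)\<close>.\<close>

lemma sum_recolor_swap:
  assumes "recolor_closed q u S"
  shows "(\<Sum>\<sigma>\<in>S. \<Sum>l\<in>{1..q}. F \<sigma> (\<sigma>(u := l))) = (\<Sum>\<sigma>\<in>S. \<Sum>l\<in>{1..q}. F (\<sigma>(u := l)) \<sigma>)"
  unfolding sum.cartesian_product
  by (rule sum.reindex_bij_witness[of _ "\<lambda>(\<sigma>, l). (\<sigma>(u := l), \<sigma> u)" "\<lambda>(\<sigma>, l). (\<sigma>(u := l), \<sigma> u)"])
     (use assms in \<open>auto simp: recolor_closed_def\<close>)

text \<open>The average is self-adjoint by \<open>sum_recolor_swap\<close> and fixes every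
  \<open>g\<close> that ignores the colour at \<open>u\<close>. The choice
  \<open>g = recolor_avg q u f\<close> yields orthogonality, \<open>g = 1\<close> the preservation
  of sums.\<close>

lemma sum_recolor_avg:
  assumes S: "recolor_closed q u S" and q: "q > 0"
    and g: "\<And>\<sigma> l. \<sigma> \<in> S \<Longrightarrow> l \<in> {1..q} \<Longrightarrow> g (\<sigma>(u := l)) = g \<sigma>"
  shows "(\<Sum>\<sigma>\<in>S. g \<sigma> * recolor_avg q u f \<sigma>) = (\<Sum>\<sigma>\<in>S. g \<sigma> * f \<sigma>)"
proof -
  have "(\<Sum>\<sigma>\<in>S. g \<sigma> * recolor_avg q u f \<sigma>) = (\<Sum>\<sigma>\<in>S. \<Sum>l\<in>{1..q}. g \<sigma> * f (\<sigma>(u := l))) / q"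
    by (simp add: recolor_avg_def sum_distrib_left sum_divide_distrib)
  also have "\<dots> = (\<Sum>\<sigma>\<in>S. \<Sum>l\<in>{1..q}. g (\<sigma>(u := l)) * f \<sigma>) / q"
    using sum_recolor_swap[OF S, of "\<lambda>\<sigma> \<tau>. g \<sigma> * f \<tau>"] by simp
  also have "(\<Sum>\<sigma>\<in>S. \<Sum>l\<in>{1..q}. g (\<sigma>(u := l)) * f \<sigma>) = (\<Sum>\<sigma>\<in>S. \<Sum>l\<in>{1..q}. g \<sigma> * f \<sigma>)"
    by (intro sum.cong refl) (simp add: g)
  finally show ?thesis using q by (simp flip: sum_distrib_left)
qed

text \<open>Cauchy-Schwarz. The constant \<open>c\<close> is kept free so that an upper bound for
  \<open>card S\<close> suffices in the application.\<close>

lemma variance_nonneg: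
  fixes f :: "'s \<Rightarrow> real" and c :: real
  assumes "finite S" "c \<ge> 0" "c * card S \<le> 1"
  shows "c * (\<Sum>x\<in>S. f x)\<^sup>2 \<le> (\<Sum>x\<in>S. (f x)\<^sup>2)"
proof -
  have "c * (\<Sum>x\<in>S. f x)\<^sup>2 \<le> c * (card S * (\<Sum>x\<in>S. (f x)\<^sup>2))"
    using assms sum_square_le_card by (intro mult_left_mono) auto
  also have "\<dots> = (c * card S) * (\<Sum>x\<in>S. (f x)\<^sup>2)" by simp
  also have "\<dots> \<le> 1 * (\<Sum>x\<in>S. (f x)\<^sup>2)"
    using assms by (intro mult_right_mono sum_nonneg) auto
  finally show ?thesis by simp
qed

text \<open>The law of total variance: the left side is the part inside the recolouring classes, and
  the rest is the variance of the averages, which \<open>variance_nonneg\<close> bounds below by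
  0.\<close>

lemma recolor_variance_le:
  fixes c :: real
  assumes S: "recolor_closed q u S" "finite S" and q: "q > 0" and c: "c \<ge> 0" "c * card S \<le> 1"
  shows "(\<Sum>\<sigma>\<in>S. (f \<sigma> - recolor_avg q u f \<sigma>)\<^sup>2) \<le> (\<Sum>\<sigma>\<in>S. (f \<sigma>)\<^sup>2) - c * (\<Sum>\<sigma>\<in>S. f \<sigma>)\<^sup>2"
proof -
  let ?a = "recolor_avg q u f"
  have "(\<Sum>\<sigma>\<in>S. (f \<sigma> - ?a \<sigma>)\<^sup>2) = (\<Sum>\<sigma>\<in>S. (f \<sigma>)\<^sup>2) - 2 * (\<Sum>\<sigma>\<in>S. ?a \<sigma> * f \<sigma>) + (\<Sum>\<sigma>\<in>S. ?a \<sigma> * ?a \<sigma>)"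
    by (simp add: sum.distrib sum_subtractf sum_distrib_left power2_eq_square algebra_simps)
  also have "(\<Sum>\<sigma>\<in>S. ?a \<sigma> * f \<sigma>) = (\<Sum>\<sigma>\<in>S. ?a \<sigma> * ?a \<sigma>)"
    by (rule sum_recolor_avg[OF S(1) q, symmetric]) simp
  finally have "(\<Sum>\<sigma>\<in>S. (f \<sigma> - ?a \<sigma>)\<^sup>2) = (\<Sum>\<sigma>\<in>S. (f \<sigma>)\<^sup>2) - (\<Sum>\<sigma>\<in>S. (?a \<sigma>)\<^sup>2)"
    by (simp add: power2_eq_square)
  moreover have "(\<Sum>\<sigma>\<in>S. f \<sigma>) = (\<Sum>\<sigma>\<in>S. ?a \<sigma>)"
    using sum_recolor_avg[OF S(1) q, of "\<lambda>_. 1" f] by simp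
  ultimately show ?thesis using variance_nonneg[OF S(2) c, of ?a] by simp
qed

text \<open>The weighted single-site average is the orthogonal projection onto the functions that do
  not depend on the colour at \<open>u\<close>, so the uniform average cannot be closer to \<open>h\<close>.\<close>

lemma heat_bath_variance_le:
  assumes S: "recolor_closed q u S" "finite S" and q: "q > 0" and w: "\<And>\<sigma>. w \<sigma> > 0"
  shows "(\<Sum>\<sigma>\<in>S. w \<sigma> * (h \<sigma>)\<^sup>2) - (\<Sum>\<sigma>\<in>S. w \<sigma> * h \<sigma> *
      ((\<Sum>l\<in>{1..q}. w (\<sigma>(u := l)) * h (\<sigma>(u := l))) / (\<Sum>j\<in>{1..q}. w (\<sigma>(u := j)))))
    \<le> (\<Sum>\<sigma>\<in>S. w \<sigma> * (h \<sigma> - recolor_avg q u h \<sigma>)\<^sup>2)"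
proof -
  define W where "W \<sigma> = (\<Sum>j\<in>{1..q}. w (\<sigma>(u := j)))" for \<sigma>
  define H where "H \<sigma> = (\<Sum>l\<in>{1..q}. w (\<sigma>(u := l)) * h (\<sigma>(u := l))) / W \<sigma>" for \<sigma>
  have W: "W \<sigma> > 0" "W (\<sigma>(u := l)) = W \<sigma>" for \<sigma> l
    using q w by (auto simp: W_def intro!: sum_pos)
  have H_upd: "H (\<sigma>(u := l)) = H \<sigma>" for \<sigma> l by (simp add: H_def W)
  \<comment> \<open>\<open>h - H\<close> is orthogonal to all functions that ignore the colour at
    \<open>u\<close>: after the swap of old and new colours, the weights of the old colours add up
    to \<open>W \<sigma>\<close>, which cancels the denominator.\<close>
  have proj: "(\<Sum>\<sigma>\<in>S. w \<sigma> * g \<sigma> * H \<sigma>) = (\<Sum>\<sigma>\<in>S. w \<sigma> * g \<sigma> * h \<sigma>)"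
    if g: "\<And>\<sigma> l. g (\<sigma>(u := l)) = g \<sigma>" for g
  proof -
    have "(\<Sum>\<sigma>\<in>S. w \<sigma> * g \<sigma> * H \<sigma>) =
        (\<Sum>\<sigma>\<in>S. \<Sum>l\<in>{1..q}. w \<sigma> * g \<sigma> * (w (\<sigma>(u := l)) * h (\<sigma>(u := l))) / W \<sigma>)"
      by (simp add: H_def sum_distrib_left sum_divide_distrib)
    also have "\<dots> = (\<Sum>\<sigma>\<in>S. \<Sum>l\<in>{1..q}. w (\<sigma>(u := l)) * g (\<sigma>(u := l)) * (w \<sigma> * h \<sigma>) / W (\<sigma>(u := l)))"
      using sum_recolor_swap[OF S(1), of "\<lambda>\<sigma> \<tau>. w \<sigma> * g \<sigma> * (w \<tau> * h \<tau>) / W \<sigma>"] .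
    also have "\<dots> = (\<Sum>\<sigma>\<in>S. W \<sigma> * (g \<sigma> * (w \<sigma> * h \<sigma>) / W \<sigma>))"
      unfolding g W(2) by (simp add: W_def sum_distrib_right sum_divide_distrib mult.assoc)
    also have "\<dots> = (\<Sum>\<sigma>\<in>S. w \<sigma> * g \<sigma> * h \<sigma>)"
      by (rule sum.cong) (use W(1) in \<open>auto simp: less_imp_neq[THEN not_sym] mult_ac\<close>)
    finally show ?thesis .
  qed
  let ?a = "recolor_avg q u h"
  \<comment> \<open>By Pythagoras, the two sides of the claim differ by exactly the weighted sum of
    \<open>(H \<sigma> - ?a \<sigma>)\<^sup>2\<close>.\<close>
  have "(\<Sum>\<sigma>\<in>S. w \<sigma> * h \<sigma> * H \<sigma>) = (\<Sum>\<sigma>\<in>S. w \<sigma> * H \<sigma> * H \<sigma>)"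
    using proj[OF H_upd] by (simp add: mult_ac)
  moreover have "(\<Sum>\<sigma>\<in>S. w \<sigma> * ?a \<sigma> * h \<sigma>) = (\<Sum>\<sigma>\<in>S. w \<sigma> * ?a \<sigma> * H \<sigma>)"
    using proj[of ?a] by simp
  moreover have "(\<Sum>\<sigma>\<in>S. w \<sigma> * (h \<sigma> - ?a \<sigma>)\<^sup>2) = (\<Sum>\<sigma>\<in>S. w \<sigma> * (h \<sigma>)\<^sup>2)
      - 2 * (\<Sum>\<sigma>\<in>S. w \<sigma> * ?a \<sigma> * h \<sigma>) + (\<Sum>\<sigma>\<in>S. w \<sigma> * ?a \<sigma> * ?a \<sigma>)"
    by (simp add: sum.distrib sum_subtractf sum_distrib_left power2_eq_square algebra_simps)
  moreover have "(\<Sum>\<sigma>\<in>S. w \<sigma> * (H \<sigma> - ?a \<sigma>)\<^sup>2) = (\<Sum>\<sigma>\<in>S. w \<sigma> * H \<sigma> * H \<sigma>)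
      - 2 * (\<Sum>\<sigma>\<in>S. w \<sigma> * ?a \<sigma> * H \<sigma>) + (\<Sum>\<sigma>\<in>S. w \<sigma> * ?a \<sigma> * ?a \<sigma>)"
    by (simp add: sum.distrib sum_subtractf sum_distrib_left power2_eq_square algebra_simps)
  moreover have "0 \<le> (\<Sum>\<sigma>\<in>S. w \<sigma> * (H \<sigma> - ?a \<sigma>)\<^sup>2)"
    by (rule sum_nonneg) (simp add: w less_imp_le)
  ultimately show ?thesis unfolding H_def W_def by linarith
qed

text \<open>The binomial theorem over subsets: every element of \<open>F\<close> is either left out
  or contributes \<open>x\<close>. It serves to expand Boltzmann weights into sums over edge
  sets.\<close>

lemma sum_Pow_power_card:
  fixes x :: "'b :: comm_semiring_1"
  assumes "finite F"
  shows "(\<Sum>A\<in>Pow F. x ^ card A) = (1 + x) ^ card F"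
  using assms
proof (induction F rule: finite_induct)
  case (insert a F)
  have "(\<Sum>A\<in>Pow (insert a F). x ^ card A) = (\<Sum>A\<in>Pow F. x ^ card A) + (\<Sum>A\<in>insert a ` Pow F. x ^ card A)"
    unfolding Pow_insert using insert by (intro sum.union_disjoint) auto
  also have "(\<Sum>A\<in>insert a ` Pow F. x ^ card A) = (\<Sum>A\<in>Pow F. x ^ card (insert a A))"
    using insert by (subst sum.reindex) (auto simp: inj_on_def o_def)
  also have "\<dots> = x * (\<Sum>A\<in>Pow F. x ^ card A)"
    unfolding sum_distrib_left
    by (rule sum.cong) (use insert in \<open>auto simp: card_insert_if finite_subset\<close>)
  finally show ?case using insert by (simp add: algebra_simps)
qed simp

section \<open>The Dirichlet forms of the two dynamics\<close>

text \<open>The restriction to \<open>V\<close> keeps the result extensional, as membership in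
  \<open>configs\<close> demands.\<close>

definition swap_colours :: "'a set \<Rightarrow> nat \<Rightarrow> nat \<Rightarrow> 'a config \<Rightarrow> 'a config" where
  "swap_colours V a b \<sigma> =
     restrict (\<lambda>x. if \<sigma> x = a then b else if \<sigma> x = b then a else \<sigma> x) V"

locale potts_model =
  fixes V :: "'a set" and E :: "'a set set" and \<beta> :: real and q :: nat and v :: 'a and k :: nat
  assumes q2: "q \<ge> 2" and \<beta>0: "\<beta> \<ge> 0" and graph: "simple_graph V E"
    and V2: "card V \<ge> 2" and v: "v \<in> V" and k: "k \<in> {1..q}"
begin

abbreviation "\<Omega> \<equiv> configs V q"
abbreviation "\<Lambda> \<equiv> configs_fixed V q v k"
abbreviation "agree \<equiv> mono_edges E"

text \<open>This is \<open>exp \<beta>\<close> times the edge probability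
  \<open>1 - exp (- \<beta>)\<close>.\<close>

definition "bond_weight = exp \<beta> - 1"
definition "weight \<sigma> = exp (\<beta> * real (card (agree \<sigma>)))"
definition "Z = (\<Sum>\<sigma>\<in>\<Omega>. weight \<sigma>)"
definition "Z\<^sub>v = (\<Sum>\<sigma>\<in>\<Lambda>. weight \<sigma>)"
definition "colourings A = {\<sigma> \<in> \<Lambda>. A \<subseteq> agree \<sigma>}"
text \<open>The exponent is minus the number of components: the factor is the probability of one
  given outcome when the components of \<open>A\<close> are coloured uniformly.\<close>

definition "cluster_weight A = bond_weight ^ card A * real q powi (- int (card (components V A)))"

section \<open>Configurations, monochromatic edges and weights\<close>

lemma finite_V: "finite V" using graph by (simp add: simple_graph_def)

lemma finite_E: "finite E"
proof -
  have "E \<subseteq> Pow V" using graph by (auto simp: simple_graph_def)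
  then show ?thesis using finite_V finite_subset by auto
qed

lemma finite_\<Omega>: "finite \<Omega>" unfolding configs_def using finite_V by (intro finite_PiE) auto

lemma finite_\<Lambda>: "finite \<Lambda>" unfolding configs_fixed_def using finite_\<Omega> by simp

lemma finite_mono: "finite (agree \<sigma>)" by (rule finite_mono_edges[OF graph])

lemma mono_subset: "agree \<sigma> \<subseteq> E" by (auto simp: mono_edges_def)

lemma mono_iff: "{a, b} \<in> agree \<sigma> \<longleftrightarrow> {a, b} \<in> E \<and> \<sigma> a = \<sigma> b"
  by (auto simp: mono_edges_def doubleton_eq_iff insert_commute)

lemma edgeE:
  assumes "e \<in> E" obtains a b where "e = {a, b}" "a \<in> V" "b \<in> V" "a \<noteq> b"
  using assms graph by (auto simp: simple_graph_def card_2_iff)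

lemma \<Lambda>_subset: "\<Lambda> \<subseteq> \<Omega>" by (auto simp: configs_fixed_def)

lemma \<Omega>_range: "\<sigma> \<in> \<Omega> \<Longrightarrow> y \<in> V \<Longrightarrow> \<sigma> y \<in> {1..q}"
  by (auto simp: configs_def PiE_def)

lemma \<Lambda>_upd: "\<sigma> \<in> \<Lambda> \<Longrightarrow> u \<in> V - {v} \<Longrightarrow> l \<in> {1..q} \<Longrightarrow> \<sigma>(u := l) \<in> \<Lambda>"
  by (auto simp: configs_fixed_def configs_def PiE_def extensional_def)

lemma recolor_closed_\<Lambda>: "u \<in> V - {v} \<Longrightarrow> recolor_closed q u \<Lambda>"
  unfolding recolor_closed_def using \<Lambda>_upd \<Lambda>_subset \<Omega>_range by blast

lemma card_\<Lambda>: "card \<Lambda> \<ge> 2" and card_\<Omega>: "card \<Omega> \<ge> 2" and \<Lambda>_ne: "\<Lambda> \<noteq> {}"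
proof -
  define s where "s = restrict (\<lambda>_. k) V"
  have s: "s \<in> \<Lambda>" using v k by (auto simp: s_def configs_fixed_def configs_def)
  then show "\<Lambda> \<noteq> {}" by auto
  have "V \<noteq> {v}" using V2 by auto
  then obtain u where u: "u \<in> V - {v}" using v by blast
  define l where "l = (if k = 1 then 2 else 1 :: nat)"
  have l: "l \<in> {1..q}" "l \<noteq> k" using q2 by (auto simp: l_def)
  have "s(u := l) \<in> \<Lambda>" using \<Lambda>_upd[OF s u l(1)] .
  moreover have "s(u := l) \<noteq> s" using l u by (auto simp: s_def fun_eq_iff)
  ultimately have "{s, s(u := l)} \<subseteq> \<Lambda>" "card {s, s(u := l)} = 2"
    using s by auto
  then show *: "card \<Lambda> \<ge> 2" using card_mono[OF finite_\<Lambda>] by metis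
  show "card \<Omega> \<ge> 2" using card_mono[OF finite_\<Omega> \<Lambda>_subset] * by simp
qed

lemma weight_pos: "weight \<sigma> > 0" by (simp add: weight_def)

lemma Z\<^sub>v_pos: "Z\<^sub>v > 0"
  unfolding Z\<^sub>v_def by (rule sum_pos) (use finite_\<Lambda> \<Lambda>_ne weight_pos in auto)

lemma bond_weight_nonneg: "bond_weight \<ge> 0" using \<beta>0 by (simp add: bond_weight_def)

lemma weight_expand: "weight \<sigma> = (\<Sum>A\<in>Pow (agree \<sigma>). bond_weight ^ card A)"
  unfolding sum_Pow_power_card[OF finite_mono] weight_def bond_weight_def
  by (simp add: exp_of_nat_mult[symmetric] mult.commute)

section \<open>Exchanging two colours, and counting compatible colourings\<close>

lemma agree_swap_colours:
  "agree (swap_colours V a b \<sigma>) = agree \<sigma>"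
proof -
  have "{y, z} \<in> agree (swap_colours V a b \<sigma>) \<longleftrightarrow> {y, z} \<in> agree \<sigma>" if "{y, z} \<in> E" for y z
  proof -
    have "y \<in> V" "z \<in> V" using that graph by (auto simp: simple_graph_def)
    then show ?thesis by (auto simp: mono_iff swap_colours_def)
  qed
  then have "e \<in> agree (swap_colours V a b \<sigma>) \<longleftrightarrow> e \<in> agree \<sigma>" if "e \<in> E" for e
    using that by (metis edgeE)
  then show ?thesis using mono_subset by blast
qed

lemma swap_colours_involution:
  assumes "\<sigma> \<in> \<Omega>" shows "swap_colours V a b (swap_colours V a b \<sigma>) = \<sigma>"
  using assms by (auto simp: swap_colours_def fun_eq_iff configs_def PiE_def extensional_def)

lemma swap_colours_in:
  assumes "\<sigma> \<in> \<Omega>" "a \<in> {1..q}" "b \<in> {1..q}" shows "swap_colours V a b \<sigma> \<in> \<Omega>"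
  using assms by (auto simp: swap_colours_def configs_def PiE_def extensional_def Pi_def)

text \<open>The configurations are sorted by the colour \<open>a\<close> of \<open>v\<close>;
  exchanging \<open>k\<close> and \<open>a\<close> everywhere maps each class bijectively onto the
  configurations with colour \<open>k\<close> at \<open>v\<close>.\<close>

lemma sum_configs_split:
  fixes F :: "'a config \<Rightarrow> real"
  assumes R: "\<And>\<sigma> a. \<sigma> \<in> \<Omega> \<Longrightarrow> R (swap_colours V k a \<sigma>) = R \<sigma>"
  shows "(\<Sum>\<sigma> | \<sigma> \<in> \<Omega> \<and> R \<sigma>. F \<sigma>) =
    (\<Sum>\<sigma> | \<sigma> \<in> \<Lambda> \<and> R \<sigma>. \<Sum>a\<in>{1..q}. F (swap_colours V k a \<sigma>))"
proof -
  have "(\<Sum>\<sigma> | \<sigma> \<in> \<Omega> \<and> R \<sigma>. F \<sigma>) = (\<Sum>a\<in>{1..q}. \<Sum>\<sigma> | \<sigma> \<in> {\<sigma> \<in> \<Omega>. R \<sigma>} \<and> \<sigma> v = a. F \<sigma>)"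
    by (rule sum.group[symmetric]) (use finite_\<Omega> \<Omega>_range v in auto)
  also have "\<dots> = (\<Sum>a\<in>{1..q}. \<Sum>\<sigma> | \<sigma> \<in> \<Lambda> \<and> R \<sigma>. F (swap_colours V k a \<sigma>))"
  proof (rule sum.cong[OF refl])
    fix a assume a: "a \<in> {1..q}"
    show "(\<Sum>\<sigma> | \<sigma> \<in> {\<sigma> \<in> \<Omega>. R \<sigma>} \<and> \<sigma> v = a. F \<sigma>) = (\<Sum>\<sigma> | \<sigma> \<in> \<Lambda> \<and> R \<sigma>. F (swap_colours V k a \<sigma>))"
    proof (rule sum.reindex_bij_witness[of _ "swap_colours V k a" "swap_colours V k a"])
      fix \<sigma> assume "\<sigma> \<in> {\<sigma> \<in> {\<sigma> \<in> \<Omega>. R \<sigma>}. \<sigma> v = a}"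
      then show "swap_colours V k a \<sigma> \<in> {\<sigma> \<in> \<Lambda>. R \<sigma>}"
        using swap_colours_in[OF _ k a] R v by (auto simp: configs_fixed_def) (simp add: swap_colours_def)
    next
      fix \<sigma> assume "\<sigma> \<in> {\<sigma> \<in> \<Lambda>. R \<sigma>}"
      then show "swap_colours V k a \<sigma> \<in> {\<sigma> \<in> {\<sigma> \<in> \<Omega>. R \<sigma>}. \<sigma> v = a}"
        using swap_colours_in[OF _ k a] R v by (auto simp: configs_fixed_def) (simp add: swap_colours_def)
    qed (use swap_colours_involution in \<open>auto simp: configs_fixed_def\<close>)
  qed
  also have "\<dots> = (\<Sum>\<sigma> | \<sigma> \<in> \<Lambda> \<and> R \<sigma>. \<Sum>a\<in>{1..q}. F (swap_colours V k a \<sigma>))"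
    by (rule sum.swap)
  finally show ?thesis .
qed

text \<open>Since the component of \<open>v\<close> has the forced colour \<open>k\<close>, only the other components are free.\<close>

lemma card_colourings: "real q * real q powi (- int (card (components V A))) * real (card (colourings A)) \<le> 1"
proof -
  define cls where "cls y = {(a, b) \<in> V \<times> V. (a, b) \<in> {(a, b). {a, b} \<in> A}\<^sup>*} `` {y}" for y
  have comps: "components V A = cls ` V"
    by (auto simp: components_def cls_def quotient_def)
  define C where "C = components V A - {cls v}"
  have fin: "finite (components V A)" using comps finite_V by simp
  have C: "card (components V A) = Suc (card C)"
    unfolding C_def by (rule card.remove[OF fin]) (use v in \<open>auto simp: comps\<close>)
  have const: "\<sigma> b = \<sigma> a" if \<sigma>: "\<sigma> \<in> colourings A" and b: "b \<in> cls a" for \<sigma> a b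
  proof -
    have "(a, b) \<in> {(a, b). {a, b} \<in> A}\<^sup>*" using b by (simp add: cls_def)
    then show ?thesis
    proof (induction rule: rtrancl_induct)
      case (step y z)
      then have "{y, z} \<in> agree \<sigma>" using \<sigma> by (auto simp: colourings_def)
      then show ?case using step.IH by (simp add: mono_iff)
    qed simp
  qed
  have self: "a \<in> cls a" if "a \<in> V" for a using that by (simp add: cls_def)
  define rep where "rep c = (SOME a. a \<in> c)" for c :: "'a set"
  have rep: "rep (cls a) \<in> cls a" if "a \<in> V" for a
    unfolding rep_def using someI[of "\<lambda>b. b \<in> cls a", OF self[OF that]] .
  define code where "code \<sigma> = restrict (\<lambda>c. \<sigma> (rep c)) C" for \<sigma> :: "'a config"
  have "inj_on code (colourings A)"
  proof (rule inj_onI)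
    fix \<sigma> \<tau> assume st: "\<sigma> \<in> colourings A" "\<tau> \<in> colourings A" and eq: "code \<sigma> = code \<tau>"
    have \<Lambda>: "\<sigma> \<in> \<Lambda>" "\<tau> \<in> \<Lambda>" using st by (auto simp: colourings_def)
    show "\<sigma> = \<tau>"
    proof
      fix y show "\<sigma> y = \<tau> y"
      proof (cases "y \<in> V")
        case False
        then show ?thesis using \<Lambda> by (auto simp: configs_fixed_def configs_def PiE_def extensional_def)
      next
        case y: True
        show ?thesis
        proof (cases "cls y = cls v")
          case True
          then have "\<sigma> y = \<sigma> v" "\<tau> y = \<tau> v" using const st self[OF y] by auto
          then show ?thesis using \<Lambda> by (simp add: configs_fixed_def)
        next
          case False
          then have "cls y \<in> C" using y by (simp add: C_def comps)
          then have "\<sigma> (rep (cls y)) = \<tau> (rep (cls y))"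
            using fun_cong[OF eq, of "cls y"] by (simp add: code_def)
          then show ?thesis using const[OF st(1) rep[OF y]] const[OF st(2) rep[OF y]] by simp
        qed
      qed
    qed
  qed
  moreover have "code ` colourings A \<subseteq> C \<rightarrow>\<^sub>E {1..q}"
  proof (intro image_subsetI PiE_I)
    fix \<sigma> c assume \<sigma>: "\<sigma> \<in> colourings A" and c: "c \<in> C"
    then obtain a where a: "a \<in> V" "c = cls a" by (auto simp: C_def comps)
    have "\<sigma> \<in> \<Omega>" using \<sigma> \<Lambda>_subset by (auto simp: colourings_def)
    then show "code \<sigma> c \<in> {1..q}"
      using c a const[OF \<sigma> rep[OF a(1)]] \<Omega>_range[of \<sigma> a] by (simp add: code_def)
  qed (simp add: code_def)
  moreover have "finite C" using fin by (simp add: C_def)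
  ultimately have "card (colourings A) \<le> card (C \<rightarrow>\<^sub>E {1..q})"
    by (intro card_inj_on_le[of code]) (auto intro: finite_PiE)
  also have "\<dots> = q ^ card C" using \<open>finite C\<close> by (simp add: card_PiE)
  finally have le: "real (card (colourings A)) \<le> real q ^ card C"
    by (metis of_nat_le_iff of_nat_power)
  \<comment> \<open>\<open>C\<close> lacks the component of \<open>v\<close>, and the leading factor
    \<open>q\<close> makes up for this difference of one.\<close>
  have eq: "real q * real q powi (- int (card (components V A))) = 1 / real q ^ card C"
    using q2 unfolding C power_int_minus power_int_of_nat by (simp add: field_simps)
  show ?thesis unfolding eq using le q2 by (simp add: divide_le_eq)
qed

lemma cluster_weight_nonneg: "cluster_weight A \<ge> 0"
  using bond_weight_nonneg by (simp add: cluster_weight_def zero_le_power_int)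

section \<open>The Swendsen-Wang form as a sum over edge sets\<close>

lemma potts_eq: "potts V E \<beta> q \<sigma> = weight \<sigma> / Z"
  by (simp add: potts_def weight_def Z_def)

text \<open>Distributing one factor \<open>exp \<beta>\<close> to each monochromatic edge, an edge
  of \<open>A\<close> contributes \<open>bond_weight\<close> and a discarded one contributes 1. What
  remains depends on \<open>\<sigma>\<close> and \<open>\<tau>\<close> only through compatibility
  with \<open>A\<close>.\<close>

lemma weight_swendsen_wang:
  "weight \<sigma> * swendsen_wang V E \<beta> q \<sigma> \<tau> =
    (\<Sum>A\<in>Pow E. cluster_weight A * of_bool (A \<subseteq> agree \<sigma>) * of_bool (A \<subseteq> agree \<tau>))"
proof -
  have *: "weight \<sigma> * ((1 - exp (- \<beta>)) ^ card A * (1 - (1 - exp (- \<beta>))) ^ (card (agree \<sigma>) - card A) * r)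
      = bond_weight ^ card A * r"
    if "A \<subseteq> agree \<sigma>" for A r
  proof -
    have le: "card A \<le> card (agree \<sigma>)" using that finite_mono by (auto intro: card_mono)
    have "weight \<sigma> = exp \<beta> ^ card (agree \<sigma>)"
      by (simp add: weight_def exp_of_nat_mult[symmetric] mult.commute)
    also have "\<dots> = exp \<beta> ^ card A * exp \<beta> ^ (card (agree \<sigma>) - card A)"
      using le by (simp flip: power_add)
    finally have "weight \<sigma> = exp \<beta> ^ card A * exp \<beta> ^ (card (agree \<sigma>) - card A)" .
    then have "weight \<sigma> * ((1 - exp (- \<beta>)) ^ card A * (1 - (1 - exp (- \<beta>))) ^ (card (agree \<sigma>) - card A) * r)
      = (exp \<beta> * (1 - exp (- \<beta>))) ^ card A * (exp \<beta> * exp (- \<beta>)) ^ (card (agree \<sigma>) - card A) * r"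
      by (simp add: power_mult_distrib mult_ac)
    also have "exp \<beta> * exp (- \<beta>) = 1" by (simp flip: exp_add)
    also have "exp \<beta> * (1 - exp (- \<beta>)) = bond_weight" by (simp add: bond_weight_def right_diff_distrib flip: exp_add)
    finally show ?thesis by simp
  qed
  have "weight \<sigma> * swendsen_wang V E \<beta> q \<sigma> \<tau> = (\<Sum>A | A \<subseteq> agree \<sigma> \<inter> agree \<tau>. cluster_weight A)"
    unfolding swendsen_wang_def Let_def sum_distrib_left cluster_weight_def
    by (rule sum.cong[OF refl], rule *) simp
  also have "\<dots> = (\<Sum>A\<in>Pow E. cluster_weight A * of_bool (A \<subseteq> agree \<sigma>) * of_bool (A \<subseteq> agree \<tau>))"
    using mono_subset finite_E by (intro sum.mono_neutral_cong_left) auto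
  finally show ?thesis .
qed

text \<open>Each edge set gives a kernel of rank one, so the form is a sum of squares; this also
  shows that it is positive semidefinite.\<close>

lemma swendsen_wang_quadratic_form:
  "(\<Sum>\<sigma>\<in>\<Omega>. weight \<sigma> * f \<sigma> * kernel_op \<Omega> (swendsen_wang V E \<beta> q) f \<sigma>) =
    (\<Sum>A\<in>Pow E. cluster_weight A * (\<Sum>\<sigma> | \<sigma> \<in> \<Omega> \<and> A \<subseteq> agree \<sigma>. f \<sigma>)\<^sup>2)"
proof -
  have ind: "(\<Sum>\<sigma> | \<sigma> \<in> \<Omega> \<and> A \<subseteq> agree \<sigma>. f \<sigma>) = (\<Sum>\<sigma>\<in>\<Omega>. f \<sigma> * of_bool (A \<subseteq> agree \<sigma>))" for A
    using finite_\<Omega> by (intro sum.mono_neutral_cong_left) auto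
  have "(\<Sum>\<sigma>\<in>\<Omega>. weight \<sigma> * f \<sigma> * kernel_op \<Omega> (swendsen_wang V E \<beta> q) f \<sigma>) =
      (\<Sum>\<sigma>\<in>\<Omega>. \<Sum>\<tau>\<in>\<Omega>. weight \<sigma> * swendsen_wang V E \<beta> q \<sigma> \<tau> * (f \<sigma> * f \<tau>))"
    by (simp add: kernel_op_def sum_distrib_left mult_ac)
  also have "\<dots> = (\<Sum>\<sigma>\<in>\<Omega>. \<Sum>\<tau>\<in>\<Omega>. \<Sum>A\<in>Pow E.
      cluster_weight A * ((f \<sigma> * of_bool (A \<subseteq> agree \<sigma>)) * (f \<tau> * of_bool (A \<subseteq> agree \<tau>))))"
    unfolding weight_swendsen_wang sum_distrib_right by (intro sum.cong refl) (simp add: mult_ac)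
  also have "\<dots> = (\<Sum>\<sigma>\<in>\<Omega>. \<Sum>A\<in>Pow E. \<Sum>\<tau>\<in>\<Omega>.
      cluster_weight A * ((f \<sigma> * of_bool (A \<subseteq> agree \<sigma>)) * (f \<tau> * of_bool (A \<subseteq> agree \<tau>))))"
    by (rule sum.cong[OF refl], rule sum.swap)
  also have "\<dots> = (\<Sum>A\<in>Pow E. \<Sum>\<sigma>\<in>\<Omega>. \<Sum>\<tau>\<in>\<Omega>.
      cluster_weight A * ((f \<sigma> * of_bool (A \<subseteq> agree \<sigma>)) * (f \<tau> * of_bool (A \<subseteq> agree \<tau>))))"
    by (rule sum.swap)
  also have "\<dots> = (\<Sum>A\<in>Pow E. cluster_weight A * (\<Sum>\<sigma> | \<sigma> \<in> \<Omega> \<and> A \<subseteq> agree \<sigma>. f \<sigma>)\<^sup>2)"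
    unfolding ind power2_eq_square sum_product by (simp add: sum_distrib_left)
  finally show ?thesis .
qed

lemma sum_colourings_swap:
  assumes "B \<subseteq> Pow E"
  shows "(\<Sum>A\<in>B. bond_weight ^ card A * (\<Sum>\<sigma>\<in>colourings A. g \<sigma>)) =
    (\<Sum>\<sigma>\<in>\<Lambda>. (\<Sum>A | A \<in> B \<and> A \<subseteq> agree \<sigma>. bond_weight ^ card A) * g \<sigma>)"
proof -
  have B: "finite B" using assms finite_E finite_subset by blast
  have "(\<Sum>A\<in>B. bond_weight ^ card A * (\<Sum>\<sigma>\<in>colourings A. g \<sigma>)) =
      (\<Sum>A\<in>B. \<Sum>\<sigma> | \<sigma> \<in> \<Lambda> \<and> A \<subseteq> agree \<sigma>. bond_weight ^ card A * g \<sigma>)"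
    by (simp add: sum_distrib_left colourings_def)
  also have "\<dots> = (\<Sum>\<sigma>\<in>\<Lambda>. \<Sum>A | A \<in> B \<and> A \<subseteq> agree \<sigma>. bond_weight ^ card A * g \<sigma>)"
    by (rule sum.swap_restrict[OF B finite_\<Lambda>])
  finally show ?thesis by (simp add: sum_distrib_right)
qed

text \<open>Only the edge sets avoiding \<open>u\<close> are used: for them \<open>u\<close> can be recoloured freely. The sum of
  their weights below \<open>agree \<sigma>\<close> loses at most the factor \<open>exp (- \<beta> * deg u)\<close> against \<open>weight \<sigma>\<close>.\<close>

lemma cluster_variance_ge:
  assumes u: "u \<in> V - {v}"
  shows "exp (- \<beta> * real (vertex_degree E u)) * (\<Sum>\<sigma>\<in>\<Lambda>. weight \<sigma> * (h \<sigma> - recolor_avg q u h \<sigma>)\<^sup>2)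
    \<le> (\<Sum>\<sigma>\<in>\<Lambda>. weight \<sigma> * (h \<sigma>)\<^sup>2) - q * (\<Sum>A\<in>Pow E. cluster_weight A * (\<Sum>\<sigma>\<in>colourings A. h \<sigma>)\<^sup>2)"
proof -
  \<comment> \<open>\<open>card_colourings\<close> makes \<open>c A\<close> admissible in
    \<open>recolor_variance_le\<close>, and \<open>bond_weight ^ card A * c A\<close> is
    \<open>q * cluster_weight A\<close>, the coefficient in the claim.\<close>
  define c where "c A = real q * real q powi (- int (card (components V A)))" for A
  define D where "D \<sigma> = (h \<sigma> - recolor_avg q u h \<sigma>)\<^sup>2" for \<sigma>
  define B where "B = {A \<in> Pow E. u \<notin> \<Union>A}"
  define var where "var A = (\<Sum>\<sigma>\<in>colourings A. (h \<sigma>)\<^sup>2) - c A * (\<Sum>\<sigma>\<in>colourings A. h \<sigma>)\<^sup>2" for A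
  have fin: "finite (colourings A)" for A using finite_\<Lambda> by (simp add: colourings_def)
  have c: "c A \<ge> 0" "c A * card (colourings A) \<le> 1" for A
    using card_colourings[of A] by (auto simp: c_def zero_le_power_int)
  have q: "q > 0" using q2 by simp
  have var: "(\<Sum>\<sigma>\<in>colourings A. D \<sigma>) \<le> var A" if "A \<in> B" for A
  proof -
    have "recolor_closed q u (colourings A)"
    proof -
      have "A \<subseteq> agree (\<sigma>(u := l))" if "A \<subseteq> agree \<sigma>" for \<sigma> l
      proof
        fix e assume e: "e \<in> A"
        then have "e \<in> agree \<sigma>" "u \<notin> e" using that \<open>A \<in> B\<close> by (auto simp: B_def)
        then show "e \<in> agree (\<sigma>(u := l))" by (fastforce simp: mono_edges_def)
      qed
      then show ?thesis
        using recolor_closed_\<Lambda>[OF u] by (auto simp: recolor_closed_def colourings_def)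
    qed
    then show ?thesis unfolding var_def D_def by (rule recolor_variance_le) (use fin q c in auto)
  qed
  have var0: "var A \<ge> 0" for A
    unfolding var_def using variance_nonneg[where f = h, OF fin c] by simp
  have low: "exp (- \<beta> * real (vertex_degree E u)) * weight \<sigma> \<le> (\<Sum>A | A \<in> B \<and> A \<subseteq> agree \<sigma>. bond_weight ^ card A)" for \<sigma>
  proof -
    let ?F = "{e \<in> agree \<sigma>. u \<notin> e}"
    have "card (agree \<sigma>) \<le> card (?F \<union> {e \<in> E. u \<in> e})"
      using finite_mono finite_E mono_subset by (intro card_mono) auto
    also have "\<dots> \<le> card ?F + vertex_degree E u"
      unfolding vertex_degree_def by (rule card_Un_le)
    finally have "\<beta> * real (card (agree \<sigma>)) \<le> \<beta> * (real (card ?F) + real (vertex_degree E u))"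
      using \<beta>0 by (intro mult_left_mono) auto
    then have "exp (- \<beta> * real (vertex_degree E u)) * weight \<sigma> \<le> exp (\<beta> * real (card ?F))"
      by (simp add: weight_def algebra_simps flip: exp_add)
    also have "\<dots> = (1 + bond_weight) ^ card ?F"
      by (simp add: bond_weight_def exp_of_nat_mult[symmetric] mult.commute)
    also have "\<dots> = (\<Sum>A\<in>Pow ?F. bond_weight ^ card A)"
      by (rule sum_Pow_power_card[symmetric]) (use finite_mono in auto)
    also have "Pow ?F = {A. A \<in> B \<and> A \<subseteq> agree \<sigma>}"
      using mono_subset by (auto simp: B_def)
    finally show ?thesis .
  qed
  have "exp (- \<beta> * real (vertex_degree E u)) * (\<Sum>\<sigma>\<in>\<Lambda>. weight \<sigma> * D \<sigma>) =
      (\<Sum>\<sigma>\<in>\<Lambda>. (exp (- \<beta> * real (vertex_degree E u)) * weight \<sigma>) * D \<sigma>)"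
    by (simp add: sum_distrib_left mult.assoc)
  also have "\<dots> \<le> (\<Sum>\<sigma>\<in>\<Lambda>. (\<Sum>A | A \<in> B \<and> A \<subseteq> agree \<sigma>. bond_weight ^ card A) * D \<sigma>)"
    by (intro sum_mono mult_right_mono low) (simp add: D_def)
  also have "\<dots> = (\<Sum>A\<in>B. bond_weight ^ card A * (\<Sum>\<sigma>\<in>colourings A. D \<sigma>))"
    by (rule sum_colourings_swap[symmetric]) (auto simp: B_def)
  also have "\<dots> \<le> (\<Sum>A\<in>B. bond_weight ^ card A * var A)"
    using bond_weight_nonneg by (intro sum_mono mult_left_mono var) auto
  \<comment> \<open>Edge sets that touch \<open>u\<close> contribute a nonnegative variance too;
    over all edge sets, \<open>weight_expand\<close> reassembles the full weight.\<close>
  also have "\<dots> \<le> (\<Sum>A\<in>Pow E. bond_weight ^ card A * var A)"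
    using finite_E bond_weight_nonneg var0 by (intro sum_mono2) (auto simp: B_def)
  also have "\<dots> = (\<Sum>A\<in>Pow E. bond_weight ^ card A * (\<Sum>\<sigma>\<in>colourings A. (h \<sigma>)\<^sup>2))
      - q * (\<Sum>A\<in>Pow E. cluster_weight A * (\<Sum>\<sigma>\<in>colourings A. h \<sigma>)\<^sup>2)"
    by (simp add: var_def c_def cluster_weight_def sum_subtractf sum_distrib_left algebra_simps)
  also have "(\<Sum>A\<in>Pow E. bond_weight ^ card A * (\<Sum>\<sigma>\<in>colourings A. (h \<sigma>)\<^sup>2)) = (\<Sum>\<sigma>\<in>\<Lambda>. weight \<sigma> * (h \<sigma>)\<^sup>2)"
  proof -
    have "{A. A \<in> Pow E \<and> A \<subseteq> agree \<sigma>} = Pow (agree \<sigma>)" for \<sigma> using mono_subset by auto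
    then show ?thesis by (subst sum_colourings_swap) (simp_all add: weight_expand)
  qed
  finally show ?thesis by (simp add: D_def)
qed

text \<open>For \<open>\<sigma>\<close> in \<open>\<Lambda>\<close> the average contains one
  configuration for each colour of \<open>v\<close>. Colours are exchanged globally, not only at
  \<open>v\<close>, so all of them have the same monochromatic edges and weight.\<close>

definition "colour_avg f \<sigma> = (\<Sum>a\<in>{1..q}. f (swap_colours V k a \<sigma>)) / q"

lemma sum_configs_colour_avg:
  assumes "\<And>\<sigma> a. \<sigma> \<in> \<Omega> \<Longrightarrow> R (swap_colours V k a \<sigma>) = R \<sigma>"
  shows "(\<Sum>\<sigma> | \<sigma> \<in> \<Omega> \<and> R \<sigma>. f \<sigma>) = q * (\<Sum>\<sigma> | \<sigma> \<in> \<Lambda> \<and> R \<sigma>. colour_avg f \<sigma>)"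
  using sum_configs_split[of R f] assms q2
  by (simp add: colour_avg_def flip: sum_divide_distrib)

lemma weight_swap_colours: "weight (swap_colours V k a \<sigma>) = weight \<sigma>"
  by (simp add: weight_def agree_swap_colours)

lemma sum_weight_configs:
  "(\<Sum>\<sigma>\<in>\<Omega>. weight \<sigma> * f \<sigma>) = (\<Sum>\<sigma>\<in>\<Lambda>. weight \<sigma> * (\<Sum>a\<in>{1..q}. f (swap_colours V k a \<sigma>)))"
proof -
  have "(\<Sum>\<sigma>\<in>\<Omega>. weight \<sigma> * f \<sigma>) =
      (\<Sum>\<sigma>\<in>\<Lambda>. \<Sum>a\<in>{1..q}. weight (swap_colours V k a \<sigma>) * f (swap_colours V k a \<sigma>))"
    using sum_configs_split[of "\<lambda>_. True"] by simp
  then show ?thesis using \<Lambda>_subset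
    by (simp add: sum_distrib_left weight_swap_colours subset_iff cong: sum.cong)
qed

lemma Z_eq: "Z = q * Z\<^sub>v"
  using sum_weight_configs[of "\<lambda>_. 1"]
  by (simp add: Z_def Z\<^sub>v_def sum_distrib_left mult.commute)

lemma Z_pos: "Z > 0" using Z_eq Z\<^sub>v_pos q2 by simp

text \<open>Cauchy-Schwarz over the colours; the factor \<open>q\<close> is the ratio of the two
  normalizing constants in \<open>Z_eq\<close>.\<close>

lemma colour_avg_square_le:
  "q * (\<Sum>\<sigma>\<in>\<Lambda>. weight \<sigma> * (colour_avg f \<sigma>)\<^sup>2) \<le> (\<Sum>\<sigma>\<in>\<Omega>. weight \<sigma> * (f \<sigma>)\<^sup>2)"
  unfolding sum_weight_configs sum_distrib_left[of "real q"]
proof (rule sum_mono)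
  fix \<sigma>
  have "(\<Sum>a\<in>{1..q}. f (swap_colours V k a \<sigma>))\<^sup>2 \<le> q * (\<Sum>a\<in>{1..q}. (f (swap_colours V k a \<sigma>))\<^sup>2)"
    using sum_square_le_card[of "{1..q}" "\<lambda>a. f (swap_colours V k a \<sigma>)"] by simp
  then have "q * (colour_avg f \<sigma>)\<^sup>2 \<le> (\<Sum>a\<in>{1..q}. (f (swap_colours V k a \<sigma>))\<^sup>2)"
    using q2 by (simp add: colour_avg_def power_divide power2_eq_square[of "real q"] field_simps)
  then have "weight \<sigma> * (q * (colour_avg f \<sigma>)\<^sup>2) \<le> weight \<sigma> * (\<Sum>a\<in>{1..q}. (f (swap_colours V k a \<sigma>))\<^sup>2)"
    by (intro mult_left_mono) (simp_all add: weight_pos less_imp_le)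
  then show "q * (weight \<sigma> * (colour_avg f \<sigma>)\<^sup>2) \<le> weight \<sigma> * (\<Sum>a\<in>{1..q}. (f (swap_colours V k a \<sigma>))\<^sup>2)"
    by (simp add: mult.left_commute)
qed

section \<open>The heat-bath kernel with the colour at \<open>v\<close> fixed\<close>

abbreviation "\<pi> \<equiv> potts V E \<beta> q"
abbreviation "\<pi>\<^sub>v \<equiv> conditional \<pi> \<Lambda>"
abbreviation "SW \<equiv> swendsen_wang V E \<beta> q"
abbreviation "HB \<equiv> heat_bath_fixed V E \<beta> q v k"

lemma conditional_eq: "\<sigma> \<in> \<Lambda> \<Longrightarrow> \<pi>\<^sub>v \<sigma> = weight \<sigma> / Z\<^sub>v"
  using Z_pos by (simp add: conditional_def potts_eq Z\<^sub>v_def flip: sum_divide_distrib)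

lemma inner_\<Omega>: "inner_on \<Omega> \<pi> f g = (\<Sum>\<sigma>\<in>\<Omega>. weight \<sigma> * f \<sigma> * g \<sigma>) / Z"
  by (simp add: inner_on_def potts_eq sum_divide_distrib)

lemma inner_\<Lambda>: "inner_on \<Lambda> \<pi>\<^sub>v f g = (\<Sum>\<sigma>\<in>\<Lambda>. weight \<sigma> * f \<sigma> * g \<sigma>) / Z\<^sub>v"
  by (simp add: inner_on_def conditional_eq sum_divide_distrib cong: sum.cong)

text \<open>Since \<open>u\<close> differs from \<open>v\<close>, every recolouring stays in
  \<open>\<Lambda>\<close>, where the conditional measure is proportional to \<open>weight\<close>;
  its default value 0 outside never enters.\<close>

lemma heat_bath_eq:
  assumes \<sigma>: "\<sigma> \<in> \<Lambda>"
  shows "HB \<sigma> \<tau> = 1 / (real (card V) - 1) * (\<Sum>u\<in>V - {v}. \<Sum>l\<in>{1..q}.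
      weight (\<sigma>(u := l)) / (\<Sum>j\<in>{1..q}. weight (\<sigma>(u := j))) * of_bool (\<tau> = \<sigma>(u := l)))"
proof -
  have "\<pi>\<^sub>v (\<sigma>(u := l)) / (\<Sum>j\<in>{1..q}. \<pi>\<^sub>v (\<sigma>(u := j))) =
      weight (\<sigma>(u := l)) / (\<Sum>j\<in>{1..q}. weight (\<sigma>(u := j)))" if "u \<in> V - {v}" "l \<in> {1..q}" for u l
  proof -
    have "\<pi>\<^sub>v (\<sigma>(u := j)) = weight (\<sigma>(u := j)) / Z\<^sub>v" if "j \<in> {1..q}" for j
      using \<Lambda>_upd[OF \<sigma> \<open>u \<in> V - {v}\<close> that] by (rule conditional_eq)
    note eq = this
    have "(\<Sum>j\<in>{1..q}. \<pi>\<^sub>v (\<sigma>(u := j))) = (\<Sum>j\<in>{1..q}. weight (\<sigma>(u := j))) / Z\<^sub>v"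
      unfolding sum_divide_distrib by (rule sum.cong) (simp_all add: eq)
    then show ?thesis using eq[OF that(2)] Z\<^sub>v_pos by simp
  qed
  note eq = this
  show ?thesis
    unfolding heat_bath_fixed_def Let_def
    by (intro arg_cong2[of _ _ _ _ times] sum.cong refl) (rule eq; assumption)
qed

lemma heat_bath_op:
  assumes \<sigma>: "\<sigma> \<in> \<Lambda>"
  shows "kernel_op \<Lambda> HB h \<sigma> = 1 / (real (card V) - 1) * (\<Sum>u\<in>V - {v}.
      (\<Sum>l\<in>{1..q}. weight (\<sigma>(u := l)) * h (\<sigma>(u := l))) / (\<Sum>j\<in>{1..q}. weight (\<sigma>(u := j))))"
proof -
  define r where "r u l = weight (\<sigma>(u := l)) / (\<Sum>j\<in>{1..q}. weight (\<sigma>(u := j)))" for u l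
  have "kernel_op \<Lambda> HB h \<sigma> = 1 / (real (card V) - 1) *
      (\<Sum>\<tau>\<in>\<Lambda>. \<Sum>u\<in>V - {v}. \<Sum>l\<in>{1..q}. r u l * (of_bool (\<tau> = \<sigma>(u := l)) * h \<tau>))"
    unfolding kernel_op_def heat_bath_eq[OF \<sigma>] r_def[symmetric]
    by (simp only: sum_distrib_left sum_distrib_right mult.assoc)
  also have "(\<Sum>\<tau>\<in>\<Lambda>. \<Sum>u\<in>V - {v}. \<Sum>l\<in>{1..q}. r u l * (of_bool (\<tau> = \<sigma>(u := l)) * h \<tau>)) =
      (\<Sum>u\<in>V - {v}. \<Sum>l\<in>{1..q}. \<Sum>\<tau>\<in>\<Lambda>. r u l * (of_bool (\<tau> = \<sigma>(u := l)) * h \<tau>))"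
    by (subst sum.swap, rule sum.cong[OF refl], rule sum.swap)
  also have "\<dots> = (\<Sum>u\<in>V - {v}. \<Sum>l\<in>{1..q}. r u l * h (\<sigma>(u := l)))"
  proof (intro sum.cong refl)
    fix u l assume ul: "u \<in> V - {v}" "l \<in> {1..q}"
    have "(\<Sum>\<tau>\<in>\<Lambda>. r u l * (of_bool (\<tau> = \<sigma>(u := l)) * h \<tau>)) =
        (\<Sum>\<tau>\<in>\<Lambda>. if \<tau> = \<sigma>(u := l) then r u l * h (\<sigma>(u := l)) else 0)"
      by (rule sum.cong) auto
    then show "(\<Sum>\<tau>\<in>\<Lambda>. r u l * (of_bool (\<tau> = \<sigma>(u := l)) * h \<tau>)) = r u l * h (\<sigma>(u := l))"
      using finite_\<Lambda> \<Lambda>_upd[OF \<sigma> ul] by simp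
  qed
  finally show ?thesis by (simp add: r_def sum_divide_distrib)
qed

lemma heat_bath_rows:
  assumes \<sigma>: "\<sigma> \<in> \<Lambda>"
  shows "(\<Sum>\<tau>\<in>\<Lambda>. HB \<sigma> \<tau>) = 1"
proof -
  have "(\<Sum>j\<in>{1..q}. weight (\<sigma>(u := j))) > 0" for u
    using q2 weight_pos by (intro sum_pos) auto
  then have "(\<Sum>j\<in>{1..q}. weight (\<sigma>(u := j))) / (\<Sum>j\<in>{1..q}. weight (\<sigma>(u := j))) = 1" for u
    by (simp add: less_imp_neq[THEN not_sym])
  then have "kernel_op \<Lambda> HB (\<lambda>_. 1) \<sigma> = 1 / (real (card V) - 1) * real (card (V - {v}))"
    unfolding heat_bath_op[OF \<sigma>] by (simp del: of_nat_diff)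
  also have "\<dots> = 1" using V2 v finite_V by (simp add: of_nat_diff)
  finally show ?thesis by (simp add: kernel_op_def)
qed

lemma heat_bath_nonneg: "\<sigma> \<in> \<Lambda> \<Longrightarrow> HB \<sigma> \<tau> \<ge> 0"
  unfolding heat_bath_eq using V2 weight_pos
  by (auto intro!: sum_nonneg mult_nonneg_nonneg divide_nonneg_nonneg simp: less_imp_le)

section \<open>Comparison of the two Dirichlet forms\<close>

definition "\<Delta> = Max (vertex_degree E ` (V - {v}))"

text \<open>The heat-bath form is the average over \<open>u\<close> of the single-site terms
  \<open>D u\<close>. Each is bounded by the same right side, since \<open>\<Delta>\<close>
  dominates every degree involved, and the average over \<open>card V - 1\<close> vertices keeps
  that bound.\<close>

lemma cluster_dirichlet_ge:
  "exp (- \<beta> * \<Delta>) * Z\<^sub>v * (inner_on \<Lambda> \<pi>\<^sub>v h h - inner_on \<Lambda> \<pi>\<^sub>v h (kernel_op \<Lambda> HB h))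
    \<le> (\<Sum>\<sigma>\<in>\<Lambda>. weight \<sigma> * (h \<sigma>)\<^sup>2) - q * (\<Sum>A\<in>Pow E. cluster_weight A * (\<Sum>\<sigma>\<in>colourings A. h \<sigma>)\<^sup>2)"
    (is "_ \<le> ?B")
proof -
  define H where "H u \<sigma> = (\<Sum>l\<in>{1..q}. weight (\<sigma>(u := l)) * h (\<sigma>(u := l))) /
      (\<Sum>j\<in>{1..q}. weight (\<sigma>(u := j)))" for u \<sigma>
  define D where "D u = (\<Sum>\<sigma>\<in>\<Lambda>. weight \<sigma> * (h \<sigma>)\<^sup>2) - (\<Sum>\<sigma>\<in>\<Lambda>. weight \<sigma> * h \<sigma> * H u \<sigma>)" for u
  define M where "M = real (card V) - 1"
  have M: "M > 0" "real (card (V - {v})) = M"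
    using V2 v finite_V by (simp_all add: M_def of_nat_diff)
  have D: "exp (- \<beta> * \<Delta>) * D u \<le> ?B" if u: "u \<in> V - {v}" for u
  proof -
    let ?R = "\<Sum>\<sigma>\<in>\<Lambda>. weight \<sigma> * (h \<sigma> - recolor_avg q u h \<sigma>)\<^sup>2"
    have "vertex_degree E u \<le> \<Delta>"
      unfolding \<Delta>_def using u finite_V by (intro Max_ge) auto
    then have "exp (- \<beta> * \<Delta>) \<le> exp (- \<beta> * vertex_degree E u)"
      using \<beta>0 by (simp add: mult_left_mono)
    moreover have "D u \<le> ?R"
      unfolding D_def H_def
      by (rule heat_bath_variance_le[OF recolor_closed_\<Lambda>[OF u] finite_\<Lambda>]) (use q2 weight_pos in auto)
    moreover have "?R \<ge> 0" by (intro sum_nonneg mult_nonneg_nonneg) (auto simp: weight_pos less_imp_le)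
    ultimately have "exp (- \<beta> * \<Delta>) * D u \<le> exp (- \<beta> * vertex_degree E u) * ?R"
      by (meson exp_ge_zero mult_left_mono mult_right_mono order_trans)
    then show ?thesis using cluster_variance_ge[OF u, of h] by linarith
  qed
  have op: "kernel_op \<Lambda> HB h \<sigma> = (\<Sum>u\<in>V - {v}. H u \<sigma>) / M" if "\<sigma> \<in> \<Lambda>" for \<sigma>
    unfolding heat_bath_op[OF that] H_def M_def by simp
  have "(\<Sum>\<sigma>\<in>\<Lambda>. weight \<sigma> * h \<sigma> * kernel_op \<Lambda> HB h \<sigma>) =
      (\<Sum>\<sigma>\<in>\<Lambda>. \<Sum>u\<in>V - {v}. weight \<sigma> * h \<sigma> * H u \<sigma>) / M"
    unfolding sum_divide_distrib
    by (rule sum.cong) (simp_all add: op sum_distrib_left sum_divide_distrib)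
  also have "\<dots> = (\<Sum>u\<in>V - {v}. \<Sum>\<sigma>\<in>\<Lambda>. weight \<sigma> * h \<sigma> * H u \<sigma>) / M"
    by (subst sum.swap) (rule refl)
  finally have "Z\<^sub>v * (inner_on \<Lambda> \<pi>\<^sub>v h h - inner_on \<Lambda> \<pi>\<^sub>v h (kernel_op \<Lambda> HB h)) = (\<Sum>u\<in>V - {v}. D u) / M"
    using Z\<^sub>v_pos M
    by (simp add: inner_\<Lambda> D_def sum_subtractf power2_eq_square mult.assoc diff_divide_distrib right_diff_distrib)
  then have "exp (- \<beta> * \<Delta>) * Z\<^sub>v * (inner_on \<Lambda> \<pi>\<^sub>v h h - inner_on \<Lambda> \<pi>\<^sub>v h (kernel_op \<Lambda> HB h)) =
      (\<Sum>u\<in>V - {v}. exp (- \<beta> * \<Delta>) * D u) / M"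
    by (simp add: mult.assoc sum_distrib_left)
  also have "\<dots> \<le> (\<Sum>u\<in>V - {v}. ?B) / M"
    using M by (intro divide_right_mono sum_mono D) auto
  also have "\<dots> = ?B" using M by simp
  finally show ?thesis .
qed

text \<open>With \<open>NF\<close>, \<open>NH\<close> and \<open>Q\<close> as in the proof, the
  Swendsen-Wang form is \<open>NF - q\<^sup>2 * Q\<close>, the sum of \<open>NF - q * NH\<close>,
  lost by averaging over colours, and \<open>q * (NH - q * Q)\<close>, handled by the heat bath. The
  factor \<open>1 / 2\<close> in the bound on \<open>c\<close> cancels the 2 of
  \<open>spectral_gap_kernel_square\<close>.\<close>

lemma spectral_gap_swendsen_wang_ge:
  assumes c: "0 \<le> c" "c \<le> exp (- \<beta> * \<Delta>) / 2"
  shows "spectral_gap (kernel_mat \<Omega> SW) \<ge> c * spectral_gap (kernel_mat \<Lambda> HB ^\<^sub>m 2)"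
proof (rule spectral_gap_ge[OF finite_\<Omega> _ reversible_swendsen_wang[OF graph] card_\<Omega>])
  fix \<sigma> show "\<pi> \<sigma> > 0" using Z_pos weight_pos by (simp add: potts_eq)
next
  fix f
  show "inner_on \<Omega> \<pi> f (kernel_op \<Omega> SW f) \<ge> 0"
    unfolding inner_\<Omega> swendsen_wang_quadratic_form using Z_pos cluster_weight_nonneg
    by (intro divide_nonneg_pos sum_nonneg mult_nonneg_nonneg) auto
next
  fix f assume f: "inner_on \<Omega> \<pi> f (\<lambda>_. 1) = 0"
  define \<gamma> where "\<gamma> = spectral_gap (kernel_mat \<Lambda> HB ^\<^sub>m 2)"
  have pos: "\<pi>\<^sub>v \<sigma> > 0" if "\<sigma> \<in> \<Lambda>" for \<sigma>
    using that Z\<^sub>v_pos weight_pos by (simp add: conditional_eq)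
  note gap = spectral_gap_kernel_square[OF finite_\<Lambda> pos reversible_heat_bath_fixed card_\<Lambda>
      heat_bath_nonneg heat_bath_rows, folded \<gamma>_def]
  define h where "h = colour_avg f"
  define NF where "NF = (\<Sum>\<sigma>\<in>\<Omega>. weight \<sigma> * (f \<sigma>)\<^sup>2)"
  define NH where "NH = (\<Sum>\<sigma>\<in>\<Lambda>. weight \<sigma> * (h \<sigma>)\<^sup>2)"
  define Q where "Q = (\<Sum>A\<in>Pow E. cluster_weight A * (\<Sum>\<sigma>\<in>colourings A. h \<sigma>)\<^sup>2)"
  have "(\<Sum>\<sigma>\<in>\<Omega>. weight \<sigma> * f \<sigma>) = q * (\<Sum>\<sigma>\<in>\<Lambda>. weight \<sigma> * h \<sigma>)"
    unfolding sum_weight_configs sum_distrib_left[of "real q"]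
    by (rule sum.cong) (use q2 in \<open>simp_all add: h_def colour_avg_def\<close>)
  then have h: "inner_on \<Lambda> \<pi>\<^sub>v h (\<lambda>_. 1) = 0"
    using f q2 Z_pos Z\<^sub>v_pos by (simp add: inner_\<Omega> inner_\<Lambda>)
  have NH0: "NH \<ge> 0" unfolding NH_def
    by (intro sum_nonneg mult_nonneg_nonneg) (auto simp: weight_pos less_imp_le)
  have hh: "inner_on \<Lambda> \<pi>\<^sub>v h h = NH / Z\<^sub>v"
    by (simp add: inner_\<Lambda> NH_def power2_eq_square mult.assoc)
  have \<gamma>: "0 \<le> \<gamma>" "\<gamma> \<le> 1" using gap(1,2) by auto
  have "\<gamma> * (NH / Z\<^sub>v) \<le> 2 * (inner_on \<Lambda> \<pi>\<^sub>v h h - inner_on \<Lambda> \<pi>\<^sub>v h (kernel_op \<Lambda> HB h))"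
    using gap(3)[of h] h hh by simp
  then have "(exp (- \<beta> * \<Delta>) * Z\<^sub>v / 2) * (\<gamma> * (NH / Z\<^sub>v)) \<le> (exp (- \<beta> * \<Delta>) * Z\<^sub>v / 2) *
      (2 * (inner_on \<Lambda> \<pi>\<^sub>v h h - inner_on \<Lambda> \<pi>\<^sub>v h (kernel_op \<Lambda> HB h)))"
    using Z\<^sub>v_pos by (intro mult_left_mono) auto
  also have "\<dots> = exp (- \<beta> * \<Delta>) * Z\<^sub>v *
      (inner_on \<Lambda> \<pi>\<^sub>v h h - inner_on \<Lambda> \<pi>\<^sub>v h (kernel_op \<Lambda> HB h))"
    by simp
  also have "\<dots> \<le> NH - q * Q"
    unfolding NH_def Q_def by (rule cluster_dirichlet_ge)
  finally have "(exp (- \<beta> * \<Delta>) / 2) * (\<gamma> * NH) \<le> NH - q * Q"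
    using Z\<^sub>v_pos by simp
  moreover have "c * (\<gamma> * NH) \<le> (exp (- \<beta> * \<Delta>) / 2) * (\<gamma> * NH)"
    using c \<gamma> NH0 by (intro mult_right_mono mult_nonneg_nonneg) auto
  ultimately have "q * (c * \<gamma> * NH) \<le> q * (NH - q * Q)"
    by (intro mult_left_mono) auto
  moreover have "q * NH \<le> NF" unfolding NH_def NF_def h_def by (rule colour_avg_square_le)
  \<comment> \<open>The part \<open>NF - q * NH\<close> enters the form with coefficient 1, so it
    carries the factor \<open>c * \<gamma>\<close> as soon as this is at most 1.\<close>
  moreover have "c * \<gamma> \<le> 1"
  proof -
    have "exp (- \<beta> * \<Delta>) \<le> 1" using \<beta>0 by simp
    then have "c \<le> 1" using c by linarith
    then show ?thesis using c \<gamma> by (simp add: mult_le_one)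
  qed
  then have "c * \<gamma> * (NF - q * NH) \<le> 1 * (NF - q * NH)"
    using \<open>q * NH \<le> NF\<close> by (intro mult_right_mono) auto
  ultimately have "c * \<gamma> * NF \<le> NF - q\<^sup>2 * Q"
    by (simp add: algebra_simps power2_eq_square)
  \<comment> \<open>Each squared sum over compatible configurations is \<open>q\<close> times a sum
    over \<open>\<Lambda>\<close>, whence the square of \<open>q\<close>.\<close>
  moreover have "(\<Sum>\<sigma>\<in>\<Omega>. weight \<sigma> * f \<sigma> * kernel_op \<Omega> SW f \<sigma>) = q\<^sup>2 * Q"
  proof -
    have "(\<Sum>\<sigma> | \<sigma> \<in> \<Omega> \<and> A \<subseteq> agree \<sigma>. f \<sigma>) = q * (\<Sum>\<sigma>\<in>colourings A. h \<sigma>)" for A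
      unfolding colourings_def h_def by (rule sum_configs_colour_avg) (simp add: agree_swap_colours)
    then show ?thesis
      unfolding swendsen_wang_quadratic_form Q_def
      by (subst sum_distrib_left) (simp add: power_mult_distrib mult.left_commute)
  qed
  ultimately show "c * spectral_gap (kernel_mat \<Lambda> HB ^\<^sub>m 2) * inner_on \<Omega> \<pi> f f
      \<le> inner_on \<Omega> \<pi> f f - inner_on \<Omega> \<pi> f (kernel_op \<Omega> SW f)"
    using Z_pos unfolding inner_\<Omega> \<gamma>_def[symmetric]
    by (simp add: NF_def power2_eq_square mult.assoc divide_right_mono flip: diff_divide_distrib)
qed

end

theorem theorem1:
  fixes V :: "'a set" and E :: "'a set set" and q k :: nat and \<beta> :: real and v :: 'a
  assumes "q \<ge> 2" and "\<beta> \<ge> 0"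
    and "simple_graph V E" and "card V \<ge> 2"
    and "v \<in> V" and "k \<in> {1..q}"
  defines "P \<equiv> kernel_mat (configs V q) (swendsen_wang V E \<beta> q)"
    and "P\<Lambda> \<equiv> kernel_mat (configs_fixed V q v k) (heat_bath_fixed V E \<beta> q v k)"
    and "\<Delta> \<equiv> Max (vertex_degree E ` (V - {v}))"
  shows "spectral_gap P \<ge>
    1 / (2 * (real q)\<^sup>2) * (real q * exp (2 * \<beta>)) powi (- 4 * int \<Delta>)
      * spectral_gap (P\<Lambda> ^\<^sub>m 2)"
proof -
  interpret M: potts_model V E \<beta> q v k
    by standard (use assms in auto)
  \<comment> \<open>The rest weakens \<open>exp (- \<beta> * \<Delta>) / 2\<close> to the stated
    constant: the base grows from \<open>exp \<beta>\<close> to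
    \<open>q * exp (2 * \<beta>)\<close>, which is at least 1, then the exponent from
    \<open>\<Delta>\<close> to \<open>4 * \<Delta>\<close>.\<close>
  have "exp \<beta> \<le> real q * exp (2 * \<beta>)"
    using mult_mono[of 1 "real q" "exp \<beta>" "exp (2 * \<beta>)"] assms(1,2) by simp
  then have "exp \<beta> ^ \<Delta> \<le> (real q * exp (2 * \<beta>)) ^ \<Delta>"
    by (intro power_mono) auto
  also have "\<dots> \<le> (real q * exp (2 * \<beta>)) ^ (4 * \<Delta>)"
    using \<open>exp \<beta> \<le> _\<close> one_le_exp_iff[of \<beta>] assms(2) by (intro power_increasing) (linarith | simp)+
  finally have le: "exp (\<beta> * \<Delta>) \<le> (real q * exp (2 * \<beta>)) ^ (4 * \<Delta>)"
    by (simp add: exp_of_nat_mult[symmetric] mult.commute)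
  have "(real q * exp (2 * \<beta>)) powi (- 4 * int \<Delta>) = 1 / (real q * exp (2 * \<beta>)) ^ (4 * \<Delta>)"
    using power_int_minus[of "real q * exp (2 * \<beta>)" "int (4 * \<Delta>)"]
    unfolding power_int_of_nat by (simp add: inverse_eq_divide)
  also have "\<dots> \<le> 1 / exp (\<beta> * \<Delta>)"
    using le by (intro divide_left_mono) (use assms(1) in auto)
  also have "\<dots> = exp (- \<beta> * \<Delta>)" by (simp add: exp_minus inverse_eq_divide)
  finally have "(real q * exp (2 * \<beta>)) powi (- 4 * int \<Delta>) \<le> exp (- \<beta> * \<Delta>)" .
  moreover have "1 / (2 * (real q)\<^sup>2) \<le> 1 / 2" using assms(1) by simp
  ultimately have "1 / (2 * (real q)\<^sup>2) * (real q * exp (2 * \<beta>)) powi (- 4 * int \<Delta>) \<le> 1 / 2 * exp (- \<beta> * \<Delta>)"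
    by (intro mult_mono) auto
  moreover have "0 \<le> 1 / (2 * (real q)\<^sup>2) * (real q * exp (2 * \<beta>)) powi (- 4 * int \<Delta>)"
    by (simp add: zero_le_power_int)
  ultimately show ?thesis
    unfolding P_def P\<Lambda>_def
    using M.spectral_gap_swendsen_wang_ge[of "1 / (2 * (real q)\<^sup>2) * (real q * exp (2 * \<beta>)) powi (- 4 * int \<Delta>)"]
    by (simp add: M.\<Delta>_def \<Delta>_def)
qed

end
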